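(* Let $d,r$ be positive integers with $1\le r\le P(d)$, assume $n$ is large enough for the binomial construction in degree $d$ (defined in the context), and let $k$ be a field with $\operatorname{char}(k)>n$ or $\operatorname{char}(k)=0$. Let $U\in\operatorname{Gr}(r,R'_d)$ with $$U=\operatorname{Span}_k\Big(\sum_{\lambda\vdash d}\boldsymbol\alpha^1_\lambda M_\lambda,\dots,\sum_{\lambda\vdash d}\boldsymbol\alpha^r_\lambda M_\lambda\Big),$$ where $\boldsymbol\alpha^i=(\boldsymbol\alpha^i_\lambda)_{\lambda\vdash d}\in k^{P(d)}$. Set $V=\operatorname{Span}_k(f_{\boldsymbol\alpha^1},\dots,f_{\boldsymbol\alpha^r})$. Let $G$ be the nonempty open subset of $\operatorname{Gr}(r,R'_d)$ described in the context. Then: 1. $V\in\operatorname{Gr}(r,R_d)$; 2. $U=\operatorname{Span}_k(\rho(f):f\in V)$; 3. If $U\in G$, then $\operatorname{Ann}_R(U^\perp+S_{\ge-d+1})=(V)_{\mathfrak S_n}$.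
   Context: $P(i)$ is the number of partitions of $i$. $R=k[x_1,\dots,x_n]$ is standard graded; $S=k[y_1,\dots,y_n]_{DP}$ is the divided power algebra with $\deg y_i=-1$; $R$ acts on $S$ by contraction ($x^{\mathbf d}\circ y^{(\mathbf e)}=y^{(\mathbf e-\mathbf d)}$ if $\mathbf e\ge\mathbf d$ componentwise, else $0$); $S_{\ge-d+1}=\bigoplus_{j\ge-d+1}S_j$; $\operatorname{Ann}_R(W)=\{f\in R:f\circ w=0\ \forall w\in W\}$. $\mathfrak S_n$ permutes variables; $R',S'$ are the invariants; $\rho(f)=\frac1{n!}\sum_{\sigma\in\mathfrak S_n}\sigma\cdot f$. For $U\subseteq R'_d$, $U^\perp=\{w\in S'_{-d}:u\circ w=0\ \forall u\in U\}$. For $V\subseteq R_d$, $(V)_{\mathfrak S_n}=(\sigma\cdot f:\sigma\in\mathfrak S_n,f\in V)$. For a partition $\lambda=(\lambda_1\ge\dots\ge\lambda_p)$, $x^\lambda=x_1^{\lambda_1}\cdots x_p^{\lambda_p}$, and $M_\lambda=\rho(x^\lambda)$. Construction of $f_{\boldsymbol\alpha}$: a monomial has type $\lambda$ if it is a permutation of $x^\lambda$. A $\lambda$-binomial is $b=M-M'$ with $M\ne M'$ monomials of type $\lambda$; with $g(b)=\gcd(M,M')$, $b$ is admissible if $g(b)$ is relatively prime to both $M/g(b)$ and $M'/g(b)$. A subpartition $\gamma\subsetneq\lambda$ is a proper sub-multiset of the parts of $\lambda$ (possibly empty). Fix an order on partitions of $d$ (e.g. lexicographic). For nonzero $\boldsymbol\alpha\in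 k^{P(d)}$ put $h_{\boldsymbol\alpha}=\sum_{\lambda\vdash d}\alpha_\lambda x^\lambda$ and let $\tau$ be smallest with $\alpha_\tau\ne0$. For each $\lambda\vdash d$, $\lambda\ne\tau$ and each $\gamma\subsetneq\lambda$ choose an admissible $\lambda$-binomial $b(\lambda,\gamma)$ with $g(b(\lambda,\gamma))$ of type $\gamma$, such that no variable in any $b(\lambda,\gamma)$ occurs in $h_{\boldsymbol\alpha}$ and distinct $b(\lambda,\gamma)$ involve disjoint sets of variables. Set $f_{\boldsymbol\alpha}=h_{\boldsymbol\alpha}+\sum_{\lambda\vdash d,\lambda\ne\tau}\sum_{\gamma\subsetneq\lambda}b(\lambda,\gamma)$. "$n$ is large enough for the construction" means such choices exist in $R$ for every nonzero $\boldsymbol\alpha$ (true for all sufficiently large $n$, depending only on $d$). The set $G$: for a subspace $W\subseteq S'_{-d}$ with basis $F_1,\dots,F_b$, let $L_W=\{(\ell_j)\in R_1^b:\sum_j\ell_j\circ F_j=0\}$. Property $\mathcal P(W)$: if $(\sum_ic_{ij}x_i)_{1\le j\le b}\in L_W$ then $c_{ij}=c_{i'j}$ for all $i,i',j$. Property $\mathcal Q(W)$: for $F\in W$, $(x_1-x_2)\circ F=0$ implies $F=0$. $G$ is a nonempty Zariski open subset of $\operatorname{Gr}(r,R'_d)$ such that for every $U\in G$, $U^\perp$ satisfies $\mathcal P(U^\perp)$, $\mathcal Q(U^\perp)$ and $\dim_kL_{U^\perp}=\max\{P(d)-P(d-1)-r,0\}$ (such a set exists). *)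

theory Defs
  imports
    "HOL-Library.Multiset"
    "HOL-Library.Poly_Mapping"
    "HOL-Combinatorics.Permutations"
    "Jordan_Normal_Form.Determinant"
begin

text \<open>
  Variables are indexed from 0: the variable written $x_i$ in mathematical prose ($1 \le i \le n$)
  is index $i - 1$, so the indices in use are those in \<open>{..<n}\<close>.

  \<open>'k mpol\<close> serves for both $R$ and $S$.  For an exponent vector \<open>m\<close>, \<open>single m 1\<close> is the monomial
  $x^m$ when read in $R$ and the divided power monomial $y^{(m)}$ when read in $S$.  The product of
  the type is the product of $R$; the divided power product of $S$ is never needed, only the
  vector space structure of $S$, its grading, and the contraction action of $R$.
\<close>

type_synonym mon = "nat \<Rightarrow>\<^sub>0 nat"
type_synonym 'k mpol = "mon \<Rightarrow>\<^sub>0 'k"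

definition mdeg :: "('i \<Rightarrow>\<^sub>0 nat) \<Rightarrow> nat" where
  "mdeg m = (\<Sum>i\<in>Poly_Mapping.keys m. Poly_Mapping.lookup m i)"

definition vars :: "'k::zero mpol \<Rightarrow> nat set" where
  "vars p = (\<Union>m\<in>Poly_Mapping.keys p. Poly_Mapping.keys m)"

definition pscale :: "'k::comm_ring_1 \<Rightarrow> 'k mpol \<Rightarrow> 'k mpol" where
  "pscale c p = Poly_Mapping.single 0 c * p"

text \<open>Tuples of polynomials are finitely supported functions on the indices \<open>0, 1, \<dots>\<close>.\<close>

definition tscale :: "'k::comm_ring_1 \<Rightarrow> (nat \<Rightarrow>\<^sub>0 'k mpol) \<Rightarrow> (nat \<Rightarrow>\<^sub>0 'k mpol)" where
  "tscale c l = Poly_Mapping.map (pscale c) l"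

interpretation pol: vector_space "pscale :: 'k::field \<Rightarrow> 'k mpol \<Rightarrow> 'k mpol"
  by unfold_locales
    (simp_all add: pscale_def distrib_left distrib_right single_add mult_single mult.assoc[symmetric])

lemma lookup_tscale: "Poly_Mapping.lookup (tscale c l) j = pscale c (Poly_Mapping.lookup l j)"
  by (simp add: tscale_def Poly_Mapping.map.rep_eq pscale_def when_def)

interpretation tup: vector_space "tscale :: 'k::field \<Rightarrow> (nat \<Rightarrow>\<^sub>0 'k mpol) \<Rightarrow> (nat \<Rightarrow>\<^sub>0 'k mpol)"
  by unfold_locales
    (simp_all add: poly_mapping_eq_iff fun_eq_iff lookup_tscale lookup_add
      pol.scale_right_distrib pol.scale_left_distrib)

subsection \<open>The polynomial ring, the divided power algebra, contraction\<close>

definition R_all :: "nat \<Rightarrow> 'k::zero mpol set" where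
  "R_all n = {p. vars p \<subseteq> {..<n}}"

definition R_deg :: "nat \<Rightarrow> nat \<Rightarrow> 'k::zero mpol set" where
  "R_deg n d = {p \<in> R_all n. \<forall>m\<in>Poly_Mapping.keys p. mdeg m = d}"

text \<open>Since $\deg y_i = -1$, the degree of $y^{(m)}$ is \<open>- int (mdeg m)\<close>.\<close>

definition S_deg :: "nat \<Rightarrow> int \<Rightarrow> 'k::zero mpol set" where
  "S_deg n j = {w. vars w \<subseteq> {..<n} \<and> (\<forall>m\<in>Poly_Mapping.keys w. - int (mdeg m) = j)}"

definition S_ge :: "nat \<Rightarrow> int \<Rightarrow> 'k::zero mpol set" where
  "S_ge n j = {w. vars w \<subseteq> {..<n} \<and> (\<forall>m\<in>Poly_Mapping.keys w. - int (mdeg m) \<ge> j)}"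

definition contract :: "'k::comm_ring_1 mpol \<Rightarrow> 'k mpol \<Rightarrow> 'k mpol" where
  "contract f w = (\<Sum>m\<in>Poly_Mapping.keys f. \<Sum>e\<in>Poly_Mapping.keys w.
     if \<forall>i. Poly_Mapping.lookup m i \<le> Poly_Mapping.lookup e i
     then Poly_Mapping.single (e - m) (Poly_Mapping.lookup f m * Poly_Mapping.lookup w e)
     else 0)"

definition Ann :: "nat \<Rightarrow> 'k::comm_ring_1 mpol set \<Rightarrow> 'k mpol set" where
  "Ann n W = {f \<in> R_all n. \<forall>w\<in>W. contract f w = 0}"

subsection \<open>The action of the symmetric group\<close>

definition perm_mon :: "(nat \<Rightarrow> nat) \<Rightarrow> mon \<Rightarrow> mon" where
  "perm_mon \<sigma> m = (\<Sum>i\<in>Poly_Mapping.keys m. Poly_Mapping.single (\<sigma> i) (Poly_Mapping.lookup m i))"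

definition perm_pol :: "(nat \<Rightarrow> nat) \<Rightarrow> 'k::comm_monoid_add mpol \<Rightarrow> 'k mpol" where
  "perm_pol \<sigma> p =
     (\<Sum>m\<in>Poly_Mapping.keys p. Poly_Mapping.single (perm_mon \<sigma> m) (Poly_Mapping.lookup p m))"

definition R_inv_deg :: "nat \<Rightarrow> nat \<Rightarrow> 'k::comm_monoid_add mpol set" where
  "R_inv_deg n d = {f \<in> R_deg n d. \<forall>\<sigma>. \<sigma> permutes {..<n} \<longrightarrow> perm_pol \<sigma> f = f}"

definition S_inv_deg :: "nat \<Rightarrow> int \<Rightarrow> 'k::comm_monoid_add mpol set" where
  "S_inv_deg n j = {w \<in> S_deg n j. \<forall>\<sigma>. \<sigma> permutes {..<n} \<longrightarrow> perm_pol \<sigma> w = w}"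

definition reynolds :: "nat \<Rightarrow> 'k::field mpol \<Rightarrow> 'k mpol" where
  "reynolds n f = pscale (1 / of_nat (fact n)) (\<Sum>\<sigma> | \<sigma> permutes {..<n}. perm_pol \<sigma> f)"

definition perp :: "nat \<Rightarrow> nat \<Rightarrow> 'k::comm_ring_1 mpol set \<Rightarrow> 'k mpol set" where
  "perp n d U = {w \<in> S_inv_deg n (- int d). \<forall>u\<in>U. contract u w = 0}"

definition sym_ideal :: "nat \<Rightarrow> 'k::comm_ring_1 mpol set \<Rightarrow> 'k mpol set" where
  "sym_ideal n V = {(\<Sum>g\<in>A. q g * g) | A q. finite A
      \<and> A \<subseteq> {perm_pol \<sigma> f | \<sigma> f. \<sigma> permutes {..<n} \<and> f \<in> V} \<and> (\<forall>g\<in>A. q g \<in> R_all n)}"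

subsection \<open>Partitions\<close>

definition partitions :: "nat \<Rightarrow> nat multiset set" where
  "partitions d = {\<mu>. 0 \<notin># \<mu> \<and> sum_mset \<mu> = d}"

definition num_partitions :: "nat \<Rightarrow> nat" where
  "num_partitions d = card (partitions d)"

text \<open>The parts of the partition, in weakly decreasing order, are the exponents of the variables
  \<open>0, 1, \<dots>\<close>.\<close>

definition xpow :: "nat multiset \<Rightarrow> mon" where
  "xpow \<mu> = Poly_Mapping.nth (rev (sorted_list_of_multiset \<mu>))"

definition Msym :: "nat \<Rightarrow> nat multiset \<Rightarrow> 'k::field mpol" where
  "Msym n \<mu> = reynolds n (Poly_Mapping.single (xpow \<mu>) 1)"

subsection \<open>The binomial construction\<close>

definition mon_has_type :: "nat \<Rightarrow> nat multiset \<Rightarrow> mon \<Rightarrow> bool" where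
  "mon_has_type n \<mu> M \<longleftrightarrow> Poly_Mapping.keys M \<subseteq> {..<n}
     \<and> (\<exists>\<sigma>. \<sigma> permutes {..<n} \<and> M = perm_mon \<sigma> (xpow \<mu>))"

definition mon_gcd :: "mon \<Rightarrow> mon \<Rightarrow> mon" where
  "mon_gcd M M' = (\<Sum>i\<in>Poly_Mapping.keys M.
     Poly_Mapping.single i (min (Poly_Mapping.lookup M i) (Poly_Mapping.lookup M' i)))"

text \<open>A binomial $M - M'$ is represented by the pair of its monomials; on exponent vectors,
  subtraction is division of monomials.\<close>

definition is_binomial :: "nat \<Rightarrow> nat multiset \<Rightarrow> mon \<times> mon \<Rightarrow> bool" where
  "is_binomial n \<mu> b \<longleftrightarrow> fst b \<noteq> snd b \<and> mon_has_type n \<mu> (fst b) \<and> mon_has_type n \<mu> (snd b)"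

definition bin_gcd :: "mon \<times> mon \<Rightarrow> mon" where
  "bin_gcd b = mon_gcd (fst b) (snd b)"

definition bin_admissible :: "mon \<times> mon \<Rightarrow> bool" where
  "bin_admissible b \<longleftrightarrow>
     Poly_Mapping.keys (bin_gcd b) \<inter> Poly_Mapping.keys (fst b - bin_gcd b) = {}
   \<and> Poly_Mapping.keys (bin_gcd b) \<inter> Poly_Mapping.keys (snd b - bin_gcd b) = {}"

definition bin_vars :: "mon \<times> mon \<Rightarrow> nat set" where
  "bin_vars b = Poly_Mapping.keys (fst b) \<union> Poly_Mapping.keys (snd b)"

definition bin_pol :: "mon \<times> mon \<Rightarrow> 'k::comm_ring_1 mpol" where
  "bin_pol b = Poly_Mapping.single (fst b) 1 - Poly_Mapping.single (snd b) 1"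

definition h_pol :: "nat \<Rightarrow> (nat multiset \<Rightarrow> 'k::comm_ring_1) \<Rightarrow> 'k mpol" where
  "h_pol d \<alpha> = (\<Sum>\<mu>\<in>partitions d. Poly_Mapping.single (xpow \<mu>) (\<alpha> \<mu>))"

text \<open>\<open>ord\<close> is the fixed (reflexive) linear order on the partitions of \<open>d\<close>.  Vectors indexed by the
  partitions of \<open>d\<close> are functions whose values off \<open>partitions d\<close> are irrelevant.  The polynomial
  $f_\alpha$ depends on choices, so the construction is a relation: \<open>f\<close> is one of the possible
  outcomes for \<open>\<alpha>\<close>.\<close>

definition is_f_alpha ::
  "nat \<Rightarrow> nat \<Rightarrow> nat multiset rel \<Rightarrow> (nat multiset \<Rightarrow> 'k::comm_ring_1) \<Rightarrow> 'k mpol \<Rightarrow> bool" where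
  "is_f_alpha n d ord \<alpha> f \<longleftrightarrow> h_pol d \<alpha> \<in> R_all n \<and>
     (\<exists>\<tau> b. \<tau> \<in> partitions d \<and> \<alpha> \<tau> \<noteq> 0
        \<and> (\<forall>\<mu>\<in>partitions d. \<alpha> \<mu> \<noteq> 0 \<longrightarrow> (\<tau>, \<mu>) \<in> ord)
        \<and> (\<forall>\<mu>\<in>partitions d - {\<tau>}. \<forall>\<gamma>. \<gamma> \<subset># \<mu> \<longrightarrow>
              is_binomial n \<mu> (b \<mu> \<gamma>) \<and> bin_admissible (b \<mu> \<gamma>)
            \<and> mon_has_type n \<gamma> (bin_gcd (b \<mu> \<gamma>))
            \<and> bin_vars (b \<mu> \<gamma>) \<inter> vars (h_pol d \<alpha>) = {})
        \<and> (\<forall>\<mu>\<in>partitions d - {\<tau>}. \<forall>\<gamma>. \<gamma> \<subset># \<mu> \<longrightarrow>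
            (\<forall>\<mu>'\<in>partitions d - {\<tau>}. \<forall>\<gamma>'. \<gamma>' \<subset># \<mu>' \<longrightarrow> (\<mu>, \<gamma>) \<noteq> (\<mu>', \<gamma>') \<longrightarrow>
              bin_vars (b \<mu> \<gamma>) \<inter> bin_vars (b \<mu>' \<gamma>') = {}))
        \<and> f = h_pol d \<alpha> + (\<Sum>\<mu>\<in>partitions d - {\<tau>}. \<Sum>\<gamma> | \<gamma> \<subset># \<mu>. bin_pol (b \<mu> \<gamma>)))"

definition large_enough :: "'k::comm_ring_1 itself \<Rightarrow> nat \<Rightarrow> nat \<Rightarrow> nat multiset rel \<Rightarrow> bool" where
  "large_enough _ n d ord \<longleftrightarrow>
     (\<forall>\<alpha> :: nat multiset \<Rightarrow> 'k. (\<exists>\<mu>\<in>partitions d. \<alpha> \<mu> \<noteq> 0) \<longrightarrow> (\<exists>f. is_f_alpha n d ord \<alpha> f))"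

subsection \<open>Grassmannians and their Zariski topology\<close>

definition Gr :: "nat \<Rightarrow> 'k::field mpol set \<Rightarrow> 'k mpol set set" where
  "Gr r A = {U. pol.subspace U \<and> U \<subseteq> A \<and> pol.dim U = r}"

definition basis_of :: "'k::field mpol list \<Rightarrow> 'k mpol set \<Rightarrow> bool" where
  "basis_of Fs W \<longleftrightarrow> distinct Fs \<and> pol.independent (set Fs) \<and> pol.span (set Fs) = W"

text \<open>Pluecker coordinates with respect to the monomial basis of the surrounding polynomial ring:
  the coordinate of the basis \<open>us\<close> at a family of monomials \<open>ms 0, ms 1, \<dots>\<close> is the corresponding
  maximal minor of the coefficient matrix.  All families are allowed as indices; the redundant
  coordinates are zero or agree up to sign with the usual ones, so they do not change the
  topology.\<close>

definition pluecker :: "'k::field mpol list \<Rightarrow> (nat \<Rightarrow> mon) \<Rightarrow> 'k" where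
  "pluecker us ms =
     det (mat (length us) (length us) (\<lambda>(i, j). Poly_Mapping.lookup (us ! i) (ms j)))"

definition homogeneous :: "(('i \<Rightarrow>\<^sub>0 nat) \<Rightarrow>\<^sub>0 'k::zero) \<Rightarrow> bool" where
  "homogeneous p \<longleftrightarrow> (\<exists>e. \<forall>m\<in>Poly_Mapping.keys p. mdeg m = e)"

definition pol_eval :: "('i \<Rightarrow> 'k) \<Rightarrow> (('i \<Rightarrow>\<^sub>0 nat) \<Rightarrow>\<^sub>0 'k::comm_ring_1) \<Rightarrow> 'k" where
  "pol_eval a p = (\<Sum>m\<in>Poly_Mapping.keys p.
     Poly_Mapping.lookup p m * (\<Prod>i\<in>Poly_Mapping.keys m. a i ^ Poly_Mapping.lookup m i))"

definition zariski_closed_Gr :: "nat \<Rightarrow> 'k::field mpol set \<Rightarrow> 'k mpol set set \<Rightarrow> bool" where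
  "zariski_closed_Gr r A Z \<longleftrightarrow>
     (\<exists>T :: (((nat \<Rightarrow> mon) \<Rightarrow>\<^sub>0 nat) \<Rightarrow>\<^sub>0 'k) set. (\<forall>p\<in>T. homogeneous p)
        \<and> Z = {U \<in> Gr r A. \<forall>p\<in>T. \<forall>us. basis_of us U \<longrightarrow> pol_eval (pluecker us) p = 0})"

definition zariski_open_Gr :: "nat \<Rightarrow> 'k::field mpol set \<Rightarrow> 'k mpol set set \<Rightarrow> bool" where
  "zariski_open_Gr r A G \<longleftrightarrow> G \<subseteq> Gr r A \<and> zariski_closed_Gr r A (Gr r A - G)"

subsection \<open>The open set\<close>

text \<open>A basis of \<open>W\<close> is fixed by choice.  Neither \<open>propP\<close> nor the dimension of \<open>lin_syz\<close> depends on
  it: a change of basis acts on the tuples by an invertible matrix with constant entries.\<close>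

definition the_basis :: "'k::field mpol set \<Rightarrow> 'k mpol list" where
  "the_basis W = (SOME Fs. basis_of Fs W)"

definition lin_syz :: "nat \<Rightarrow> 'k::field mpol set \<Rightarrow> (nat \<Rightarrow>\<^sub>0 'k mpol) set" where
  "lin_syz n W = (let Fs = the_basis W; b = length Fs in
     {l. Poly_Mapping.keys l \<subseteq> {..<b} \<and> (\<forall>j<b. Poly_Mapping.lookup l j \<in> R_deg n 1)
        \<and> (\<Sum>j<b. contract (Poly_Mapping.lookup l j) (Fs ! j)) = 0})"

definition xvar :: "nat \<Rightarrow> 'k::comm_ring_1 mpol" where
  "xvar i = Poly_Mapping.single (Poly_Mapping.single i 1) 1"

definition propP :: "nat \<Rightarrow> 'k::field mpol set \<Rightarrow> bool" where
  "propP n W \<longleftrightarrow> (let b = length (the_basis W) in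
     \<forall>c :: nat \<Rightarrow> nat \<Rightarrow> 'k.
       (\<Sum>j<b. Poly_Mapping.single j (\<Sum>i<n. pscale (c i j) (xvar i))) \<in> lin_syz n W \<longrightarrow>
       (\<forall>i<n. \<forall>i'<n. \<forall>j<b. c i j = c i' j))"

definition propQ :: "'k::field mpol set \<Rightarrow> bool" where
  "propQ W \<longleftrightarrow> (\<forall>F\<in>W. contract (xvar 0 - xvar 1) F = 0 \<longrightarrow> F = 0)"

definition good_open_set :: "nat \<Rightarrow> nat \<Rightarrow> nat \<Rightarrow> 'k::field mpol set set \<Rightarrow> bool" where
  "good_open_set n d r G \<longleftrightarrow> G \<noteq> {} \<and> zariski_open_Gr r (R_inv_deg n d) G
     \<and> (\<forall>U\<in>G. propP n (perp n d U) \<and> propQ (perp n d U)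
          \<and> int (tup.dim (lin_syz n (perp n d U)))
              = max (int (num_partitions d) - int (num_partitions (d - 1)) - int r) 0)"

end

theory Submission
  imports Defs
begin

text \<open>
  Write $I = (V)_{\mathfrak S_n}$.  If $x_i$ and $x_j$ are the two variables distinguishing the monomials of
  $b(\lambda, \lambda \setminus \{a\})$, then interchanging them in $f_\alpha$ only negates this
  binomial, so $2 b \in I$.  Moving these binomials around by permutations shows that $I_d$ contains
  all differences of monomials of equal type, first for types $\lambda \ne \tau$ and then, from
  $f_\alpha - \sigma f_\alpha$, for $\tau$.  Hence $I_d$ consists of the $f$ with
  $\rho(f) \in U$, and by duality on the coefficients this is the degree $d$ part of the annihilator.

  Since $n \ge d + 2$ when $d \ge 2$, it follows that $(x_p - x_q) R_d \subseteq I$, so all monomials of degree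
  $d + 1$ are congruent modulo $I$.  Multiplying an $f_\alpha$ by a variable then puts all of them
  into $I$, unless the coefficients of every $\alpha^i$ sum to $0$.  In that case the sum $F$ of all
  divided power monomials of degree $d$ lies in $U^\perp$ and is killed by $x_1 - x_2$,
  contradicting $\mathcal Q(U^\perp)$.
\<close>

text \<open>The bound on n is read off from a single f_alpha. Its h_alpha occupies at least as many
  variables as \<tau> has parts, and a binomial for \<mu> with one part dropped occupies
  \<open>size \<mu> + 1\<close> further ones. Taking (d) or 1^d for \<mu> gives n >= d + 2 once d >=
  2, so a monomial of degree d always misses some variable, and the exchanges of variables pass
  through it. For d = 1 there is one partition and no binomial; n = 1 is then possible and is
  carried along as a separate case.

  The type \<tau> has no binomials of its own; its nonzero coefficient replaces them, since modulo
  the other types f - \<sigma> f is \<alpha>_\<tau> (x^\<tau> - \<sigma> x^\<tau>).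

  Congruences in degree d are proved in the k-span of the orbit of V, which is stable under
  permutations by linearity, and then transferred to the ideal. Multiplication by variables enters
  from degree d + 1 on.

  For the duality, an element of S' of degree -d is a function c of the type, and M_\<lambda> pairs
  with it to c_\<lambda>. Hence the perp of U consists of the vectors orthogonal to all \<alpha>^i,
  and membership in the span of the \<alpha>^i is tested by functionals.\<close>

abbreviation (input) lookup :: "('a \<Rightarrow>\<^sub>0 'b::zero) \<Rightarrow> 'a \<Rightarrow> 'b" where "lookup \<equiv> Poly_Mapping.lookup"
abbreviation (input) keys :: "('a \<Rightarrow>\<^sub>0 'b::zero) \<Rightarrow> 'a set" where "keys \<equiv> Poly_Mapping.keys"
abbreviation (input) single :: "'a \<Rightarrow> 'b \<Rightarrow> ('a \<Rightarrow>\<^sub>0 'b::zero)" where "single \<equiv> Poly_Mapping.single"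

lemma sum_single_lookup:
  fixes p :: "'a \<Rightarrow>\<^sub>0 'b::comm_monoid_add"
  shows "(\<Sum>k\<in>keys p. single k (lookup p k)) = p"
proof (rule poly_mapping_eqI)
  fix k
  show "lookup (\<Sum>k\<in>keys p. single k (lookup p k)) k = lookup p k"
    by (simp add: lookup_sum lookup_single when_def sum.delta in_keys_iff)
qed

lemma keys_plus_mon: "keys (a + b :: 'a \<Rightarrow>\<^sub>0 nat) = keys a \<union> keys b"
  by (auto simp: in_keys_iff lookup_add)

lemma lookup_pscale [simp]: "lookup (pscale c p) m = c * lookup p m"
  unfolding pscale_def mult_map_scale_conv_mult[symmetric]
  by (simp add: Poly_Mapping.map.rep_eq when_def)

lemma pscale_single: "pscale c (single m a) = single m (c * a)"
  by (simp add: pscale_def mult_single)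

lemma keys_pscale: "keys (pscale c p) \<subseteq> keys p"
  by (auto simp: in_keys_iff)

subsection \<open>Monomials\<close>

lemma sum_keys_superset:
  assumes "finite A" "keys p \<subseteq> A" "\<And>k. g k 0 = 0"
  shows "(\<Sum>k\<in>keys p. g k (lookup p k)) = (\<Sum>k\<in>A. g k (lookup p k))"
  by (rule sum.mono_neutral_left) (use assms in \<open>auto simp: in_keys_iff\<close>)

lemma mdeg_superset: "finite A \<Longrightarrow> keys m \<subseteq> A \<Longrightarrow> mdeg m = (\<Sum>i\<in>A. lookup m i)"
  unfolding mdeg_def using sum_keys_superset[of A m "\<lambda>_ x. x"] by simp

lemma mdeg_plus [simp]: "mdeg (a + b) = mdeg a + mdeg b"
proof -
  let ?A = "keys a \<union> keys b"
  have "finite ?A" by simp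
  then show ?thesis
    using mdeg_superset[of ?A a] mdeg_superset[of ?A b] mdeg_superset[of ?A "a + b"]
    by (simp add: keys_plus_mon lookup_add sum.distrib)
qed

lemma mdeg_single [simp]: "mdeg (single i a) = a"
  by (simp add: mdeg_def)

lemma mdeg_0 [simp]: "mdeg 0 = 0"
  by (simp add: mdeg_def)

lemma mdeg_eq_0_iff: "mdeg m = 0 \<longleftrightarrow> m = 0"
proof
  assume "mdeg m = 0"
  then have "\<forall>i\<in>keys m. lookup m i = 0"
    by (simp add: mdeg_def)
  then have "keys m = {}"
    unfolding in_keys_iff by blast
  then show "m = 0"
    by simp
qed simp

lemma lookup_le_mdeg: "lookup m i \<le> mdeg m"
proof (cases "i \<in> keys m")
  case True
  then show ?thesis
    unfolding mdeg_def by (intro member_le_sum) auto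
qed (simp add: in_keys_iff)

definition mons :: "nat \<Rightarrow> nat \<Rightarrow> mon set" where
  "mons n d = {m. keys m \<subseteq> {..<n} \<and> mdeg m = d}"

lemma finite_mons [simp]: "finite (mons n d)"
proof -
  have "lookup ` mons n d \<subseteq> {f. \<forall>i. (i \<in> {..<n} \<longrightarrow> f i \<in> {..d}) \<and> (i \<notin> {..<n} \<longrightarrow> f i = 0)}"
  proof (clarsimp simp: mons_def)
    fix m :: mon and i
    assume "keys m \<subseteq> {..<n}"
    then show "(i < n \<longrightarrow> lookup m i \<le> mdeg m) \<and> (\<not> i < n \<longrightarrow> lookup m i = 0)"
      using lookup_le_mdeg[of m i] by (auto simp: in_keys_iff)
  qed
  then have "finite (lookup ` mons n d)"
    by (rule finite_subset) (rule finite_set_of_finite_funs, auto)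
  then show ?thesis
    by (rule finite_imageD) (simp add: inj_on_def)
qed

text \<open>The first form strips the whole power of a variable, so that the variable disappears
  from the remainder and types can be compared; the second strips one factor and serves inductions
  on the degree.\<close>

lemma monomial_split:
  assumes "i \<in> keys (m :: 'a \<Rightarrow>\<^sub>0 nat)"
  shows "single i (lookup m i) + (m - single i (lookup m i)) = m"
    and "single i 1 + (m - single i 1) = m"
  using assms by (auto intro!: poly_mapping_eqI simp: lookup_add lookup_minus lookup_single when_def in_keys_iff)

subsection \<open>Types of monomials\<close>

text \<open>A computable invariant in place of the existential statement
  \<open>mon_has_type\<close>; \<open>mon_has_type_iff\<close> connects the two.\<close>

definition mtype :: "mon \<Rightarrow> nat multiset" where
  "mtype m = image_mset (lookup m) (mset_set (keys m))"

lemma zero_notin_mtype [simp]: "0 \<notin># mtype m"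
  by (auto simp: mtype_def in_keys_iff)

lemma sum_mtype [simp]: "sum_mset (mtype m) = mdeg m"
  by (simp add: mtype_def mdeg_def sum_unfold_sum_mset)

lemma size_mtype: "size (mtype m) = card (keys m)"
  by (simp add: mtype_def)

text \<open>Coprimality is exactly what admissibility of a binomial supplies for its gcd and the two
  cofactors.\<close>

lemma mtype_plus:
  assumes "keys a \<inter> keys b = {}"
  shows "mtype (a + b) = mtype a + mtype b"
proof -
  have "image_mset (lookup (a + b)) (mset_set (keys a)) = mtype a"
    unfolding mtype_def using assms
    by (intro image_mset_cong) (auto simp: lookup_add in_keys_iff)
  moreover have "image_mset (lookup (a + b)) (mset_set (keys b)) = mtype b"
    unfolding mtype_def using assms
    by (intro image_mset_cong) (auto simp: lookup_add in_keys_iff)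
  ultimately show ?thesis
    using assms by (simp add: mtype_def[of "a + b"] keys_plus_mon mset_set_Union)
qed

lemma mtype_single: "a > 0 \<Longrightarrow> mtype (single i a) = {#a#}"
  by (simp add: mtype_def)

lemma mtype_eq_single_imp:
  assumes "mtype m = {#a#}"
  obtains i where "m = single i a"
proof -
  have "card (keys m) = 1"
    using assms size_mtype[of m] by simp
  then obtain i where i: "keys m = {i}"
    by (auto simp: card_1_singleton_iff)
  then have "lookup m i = a"
    using assms by (simp add: mtype_def)
  then have "m = single i a"
    using i by (intro poly_mapping_eqI) (auto simp: lookup_single when_def in_keys_iff)
  then show ?thesis using that by blast
qed

lemma mtype_in_partitions [simp]: "m \<in> mons n d \<Longrightarrow> mtype m \<in> partitions d"
  by (auto simp: partitions_def mons_def)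

lemma size_le_sum_mset: "0 \<notin># \<mu> \<Longrightarrow> size \<mu> \<le> sum_mset (\<mu> :: nat multiset)"
  by (induction \<mu>) auto

lemma size_partition: "\<mu> \<in> partitions d \<Longrightarrow> size \<mu> \<le> d"
  using size_le_sum_mset by (auto simp: partitions_def)

lemma lookup_xpow:
  "lookup (xpow \<mu>) i = (if i < size \<mu> then rev (sorted_list_of_multiset \<mu>) ! i else 0)"
  by (simp add: xpow_def nth_default_def) (metis size_mset mset_sorted_list_of_multiset)

lemma keys_xpow:
  assumes "0 \<notin># \<mu>"
  shows "keys (xpow \<mu>) = {..<size \<mu>}"
proof -
  let ?xs = "rev (sorted_list_of_multiset \<mu>)"
  have len: "length ?xs = size \<mu>"
    by (metis length_rev size_mset mset_sorted_list_of_multiset)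
  have "?xs ! i \<noteq> 0" if "i < size \<mu>" for i
    using that assms nth_mem[of i ?xs] len by (metis set_rev set_sorted_list_of_multiset)
  then show ?thesis
    by (auto simp: in_keys_iff lookup_xpow split: if_splits)
qed

lemma mtype_xpow:
  assumes "0 \<notin># \<mu>"
  shows "mtype (xpow \<mu>) = \<mu>"
proof -
  let ?xs = "rev (sorted_list_of_multiset \<mu>)"
  have len: "length ?xs = size \<mu>"
    by (metis length_rev size_mset mset_sorted_list_of_multiset)
  have "mtype (xpow \<mu>) = image_mset ((!) ?xs) (mset_set {..<size \<mu>})"
    unfolding mtype_def keys_xpow[OF assms] by (intro image_mset_cong) (auto simp: lookup_xpow)
  also have "\<dots> = mset (map ((!) ?xs) [0..<length ?xs])"
    unfolding len by (simp add: atLeast0LessThan)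
  also have "\<dots> = \<mu>"
    by (subst map_nth) simp
  finally show ?thesis .
qed

lemma xpow_in_mons: "\<mu> \<in> partitions d \<Longrightarrow> d \<le> n \<Longrightarrow> xpow \<mu> \<in> mons n d"
  using size_partition[of \<mu> d] sum_mtype[of "xpow \<mu>"]
  by (auto simp: mons_def partitions_def keys_xpow mtype_xpow)

text \<open>Every partition of d is the type of a monomial of degree d in d variables, because it
  has at most d parts.\<close>

lemma finite_partitions [simp]: "finite (partitions d)"
proof (rule finite_subset)
  show "partitions d \<subseteq> mtype ` mons d d"
    using xpow_in_mons[of _ d d] by (force simp: partitions_def mtype_xpow)
qed simp

subsection \<open>The action of permutations\<close>

lemma lookup_perm_mon:
  assumes "inj \<sigma>"
  shows "lookup (perm_mon \<sigma> m) (\<sigma> i) = lookup m i"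
proof -
  have "lookup (perm_mon \<sigma> m) (\<sigma> i) = (\<Sum>j\<in>keys m. if i = j then lookup m j else 0)"
    unfolding perm_mon_def lookup_sum lookup_single
    by (intro sum.cong) (auto simp: when_def inj_eq[OF assms])
  then show ?thesis
    by (simp add: in_keys_iff)
qed

lemma lookup_perm_mon': "\<sigma> permutes S \<Longrightarrow> lookup (perm_mon \<sigma> m) i = lookup m (Hilbert_Choice.inv \<sigma> i)"
  using lookup_perm_mon[of \<sigma> m "Hilbert_Choice.inv \<sigma> i"] by (simp add: permutes_inj permutes_inverses)

lemma keys_perm_mon:
  assumes "\<sigma> permutes S" shows "keys (perm_mon \<sigma> m) = \<sigma> ` keys m"
proof (intro equalityI subsetI)
  fix i assume "i \<in> keys (perm_mon \<sigma> m)"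
  then have "Hilbert_Choice.inv \<sigma> i \<in> keys m"
    using assms by (simp add: in_keys_iff lookup_perm_mon')
  moreover have "i = \<sigma> (Hilbert_Choice.inv \<sigma> i)"
    by (simp add: permutes_inverses(1)[OF assms])
  ultimately show "i \<in> \<sigma> ` keys m" by (rule rev_image_eqI)
next
  fix i assume "i \<in> \<sigma> ` keys m"
  then show "i \<in> keys (perm_mon \<sigma> m)"
    using lookup_perm_mon[OF permutes_inj[OF assms], of m] by (auto simp: in_keys_iff)
qed

lemma perm_mon_plus:
  assumes "\<sigma> permutes S" shows "perm_mon \<sigma> (a + b) = perm_mon \<sigma> a + perm_mon \<sigma> b"
  using assms by (intro poly_mapping_eqI) (simp add: lookup_perm_mon' lookup_add)

lemma perm_mon_single [simp]: "perm_mon \<sigma> (single i a) = single (\<sigma> i) a"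
  by (simp add: perm_mon_def)

lemma perm_mon_comp:
  assumes "\<sigma> permutes S" "\<pi> permutes S"
  shows "perm_mon \<sigma> (perm_mon \<pi> m) = perm_mon (\<sigma> \<circ> \<pi>) m"
  using assms permutes_compose[OF assms(2,1)]
  by (intro poly_mapping_eqI) (simp add: lookup_perm_mon' o_inv_distrib permutes_bij)

lemma perm_mon_id [simp]: "perm_mon id m = m"
  by (simp add: perm_mon_def sum_single_lookup)

lemma perm_mon_fix:
  assumes "\<And>i. i \<in> keys m \<Longrightarrow> \<sigma> i = i" shows "perm_mon \<sigma> m = m"
  using assms by (simp add: perm_mon_def sum_single_lookup)

lemma mdeg_perm_mon [simp]:
  assumes "\<sigma> permutes S" shows "mdeg (perm_mon \<sigma> m) = mdeg m"
proof -
  have "inj_on \<sigma> (keys m)"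
    using permutes_inj[OF assms] by (rule inj_on_subset) simp
  then show ?thesis
    using assms by (simp add: mdeg_def keys_perm_mon sum.reindex lookup_perm_mon permutes_inj)
qed

lemma mtype_perm_mon [simp]:
  assumes "\<sigma> permutes S" shows "mtype (perm_mon \<sigma> m) = mtype m"
proof -
  have "mset_set (\<sigma> ` keys m) = image_mset \<sigma> (mset_set (keys m))"
    using assms by (intro image_mset_mset_set[symmetric]) (auto intro: inj_on_subset dest: permutes_inj)
  then show ?thesis
    using assms by (simp add: mtype_def keys_perm_mon multiset.map_comp o_def lookup_perm_mon permutes_inj)
qed

lemma perm_mon_in_mons [simp]:
  assumes "\<sigma> permutes {..<n}" "m \<in> mons n d"
  shows "perm_mon \<sigma> m \<in> mons n d"
proof -
  have "\<sigma> ` keys m \<subseteq> \<sigma> ` {..<n}"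
    using assms(2) by (intro image_mono) (simp add: mons_def)
  then show ?thesis
    using assms by (simp add: mons_def keys_perm_mon[OF assms(1)] permutes_image[OF assms(1)])
qed

text \<open>Listing the exponents at all n indices pads the type with zeros. Equal types have
  equally many parts, so the padded lists agree as multisets and differ by a permutation of the
  indices.\<close>

lemma mtype_eq_imp_perm:
  assumes "keys m \<subseteq> {..<n}" "keys m' \<subseteq> {..<n}" "mtype m = mtype m'"
  obtains \<sigma> where "\<sigma> permutes {..<n}" "m' = perm_mon \<sigma> m"
proof -
  have *: "mset (map (lookup m) [0..<n]) = mtype m + replicate_mset (n - card (keys m)) 0"
    if "keys m \<subseteq> {..<n}" for m :: mon
  proof -
    have "mset (map (lookup m) [0..<n]) = image_mset (lookup m) (mset_set {..<n})"
      by (simp add: atLeast0LessThan)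
    also have "{..<n} = keys m \<union> ({..<n} - keys m)"
      using that by auto
    also have "image_mset (lookup m) (mset_set \<dots>)
        = mtype m + image_mset (lookup m) (mset_set ({..<n} - keys m))"
      by (subst mset_set_Union) (auto simp: mtype_def)
    also have "image_mset (lookup m) (mset_set ({..<n} - keys m))
        = image_mset (\<lambda>_. 0) (mset_set ({..<n} - keys m))"
      by (intro image_mset_cong) (auto simp: in_keys_iff)
    also have "\<dots> = replicate_mset (n - card (keys m)) 0"
      using that by (simp add: image_mset_const_eq card_Diff_subset)
    finally show ?thesis .
  qed
  have "card (keys m) = card (keys m')"
    using assms(3) by (metis size_mtype)
  then have "mset (map (lookup m') [0..<n]) = mset (map (lookup m) [0..<n])"
    using assms by (simp add: * del: mset_map)
  then obtain p where p: "p permutes {..<n}" "permute_list p (map (lookup m) [0..<n]) = map (lookup m') [0..<n]"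
    by (rule mset_eq_permutation) simp
  have eq: "lookup m' i = lookup m (p i)" for i
  proof (cases "i < n")
    case True
    have "lookup m' i = permute_list p (map (lookup m) [0..<n]) ! i"
      using p True by simp
    also have "\<dots> = lookup m (p i)"
      using p(1) True permutes_in_image[OF p(1), of i] by (simp add: permute_list_nth)
    finally show ?thesis .
  next
    case False
    moreover have "p i = i"
      using False p(1) by (auto simp: permutes_def)
    moreover have "i \<notin> keys m" "i \<notin> keys m'"
      using False assms(1,2) by auto
    ultimately show ?thesis
      by (simp add: in_keys_iff)
  qed
  \<comment> \<open>The permutation found acts on lists by precomposition with p, whereas
    \<open>perm_mon\<close> pushes exponents forward; hence the inverse.\<close>
  have "m' = perm_mon (Hilbert_Choice.inv p) m"
    using p(1) by (intro poly_mapping_eqI) (simp add: eq lookup_perm_mon'[OF permutes_inv] permutes_inv_inv)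
  then show ?thesis
    using that permutes_inv[OF p(1)] by blast
qed

lemma mon_has_type_iff:
  assumes "0 \<notin># \<mu>"
  shows "mon_has_type n \<mu> m \<longleftrightarrow> keys m \<subseteq> {..<n} \<and> mtype m = \<mu>"
proof
  assume "mon_has_type n \<mu> m"
  then show "keys m \<subseteq> {..<n} \<and> mtype m = \<mu>"
    by (auto simp: mon_has_type_def mtype_xpow[OF assms])
next
  assume m: "keys m \<subseteq> {..<n} \<and> mtype m = \<mu>"
  then have "size \<mu> \<le> n"
    using card_mono[of "{..<n}" "keys m"] by (auto simp: size_mtype)
  then have "keys (xpow \<mu>) \<subseteq> {..<n}"
    by (auto simp: keys_xpow[OF assms])
  then obtain \<sigma> where "\<sigma> permutes {..<n}" "m = perm_mon \<sigma> (xpow \<mu>)"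
    using m by (metis mtype_eq_imp_perm mtype_xpow[OF assms])
  then show "mon_has_type n \<mu> m"
    using m by (auto simp: mon_has_type_def)
qed

subsection \<open>Polynomials\<close>

lemma perm_pol_superset:
  assumes "finite A" "keys p \<subseteq> A"
  shows "perm_pol \<sigma> p = (\<Sum>m\<in>A. single (perm_mon \<sigma> m) (lookup p m))"
  unfolding perm_pol_def
  using sum_keys_superset[OF assms, of "\<lambda>m c. single (perm_mon \<sigma> m) c"] by simp

lemma perm_pol_add [simp]: "perm_pol \<sigma> (p + q) = perm_pol \<sigma> p + perm_pol \<sigma> q"
proof -
  let ?A = "keys p \<union> keys q"
  have "finite ?A" by simp
  then show ?thesis
    using keys_add[of p q] perm_pol_superset[of ?A p] perm_pol_superset[of ?A q]
      perm_pol_superset[of ?A "p + q"]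
    by (simp add: lookup_add single_add sum.distrib)
qed

lemma perm_pol_0 [simp]: "perm_pol \<sigma> 0 = 0"
  by (simp add: perm_pol_def)

lemma perm_pol_single [simp]: "perm_pol \<sigma> (single m c) = single (perm_mon \<sigma> m) c"
  by (cases "c = 0") (auto simp: perm_pol_def)

lemma perm_pol_sum [simp]: "perm_pol \<sigma> (sum g A) = (\<Sum>a\<in>A. perm_pol \<sigma> (g a))"
  by (induction A rule: infinite_finite_induct) auto

lemma perm_pol_pscale [simp]: "perm_pol \<sigma> (pscale c p) = pscale c (perm_pol \<sigma> p)"
  for p :: "'k::field mpol"
proof -
  have "perm_pol \<sigma> (pscale c p) = (\<Sum>m\<in>keys p. single (perm_mon \<sigma> m) (c * lookup p m))"
    using perm_pol_superset[OF _ keys_pscale[of c p]] by simp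
  then show ?thesis
    by (simp add: perm_pol_def pol.scale_sum_right pscale_single)
qed

lemma perm_pol_diff [simp]: "perm_pol \<sigma> (p - q) = perm_pol \<sigma> p - perm_pol \<sigma> q"
  for p :: "'k::ab_group_add mpol"
  by (metis perm_pol_add add_diff_cancel_right' diff_add_cancel)

lemma perm_pol_comp:
  assumes "\<sigma> permutes S" "\<pi> permutes S"
  shows "perm_pol \<sigma> (perm_pol \<pi> p) = perm_pol (\<sigma> \<circ> \<pi>) p"
  by (simp add: perm_pol_def[of \<pi>] perm_mon_comp[OF assms]) (simp add: perm_pol_def)

lemma perm_pol_id [simp]: "perm_pol id p = p"
  by (simp add: perm_pol_def sum_single_lookup)

lemma perm_pol_fix:
  assumes "\<And>i. i \<in> vars p \<Longrightarrow> \<sigma> i = i" shows "perm_pol \<sigma> p = p"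
proof -
  have "perm_pol \<sigma> p = (\<Sum>m\<in>keys p. single m (lookup p m))"
    unfolding perm_pol_def using assms
    by (intro sum.cong refl arg_cong2[where f = single] perm_mon_fix) (auto simp: vars_def)
  then show ?thesis by (simp add: sum_single_lookup)
qed

lemma R_all_iff: "p \<in> R_all n \<longleftrightarrow> (\<forall>m\<in>keys p. keys m \<subseteq> {..<n})"
  by (auto simp: R_all_def vars_def)

lemma R_deg_iff: "p \<in> R_deg n d \<longleftrightarrow> keys p \<subseteq> mons n d"
  by (auto simp: R_deg_def R_all_iff mons_def)

lemma S_deg_iff: "p \<in> S_deg n (- int d) \<longleftrightarrow> keys p \<subseteq> mons n d"
  by (auto simp: S_deg_def vars_def mons_def)

lemma S_ge_iff:
  "p \<in> S_ge n (- int d + 1) \<longleftrightarrow> (\<forall>m\<in>keys p. keys m \<subseteq> {..<n} \<and> mdeg m < d)"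
  by (auto simp: S_ge_def vars_def)

lemma subspace_R_deg: "pol.subspace (R_deg n d)"
proof (rule pol.subspaceI)
  show "0 \<in> R_deg n d" by (simp add: R_deg_iff)
  show "x + y \<in> R_deg n d" if "x \<in> R_deg n d" "y \<in> R_deg n d" for x y :: "'a mpol"
    using that keys_add[of x y] by (auto simp: R_deg_iff)
  show "pscale c x \<in> R_deg n d" if "x \<in> R_deg n d" for c and x :: "'a mpol"
    using that keys_pscale[of c x] by (auto simp: R_deg_iff)
qed

lemma single_in_R_deg: "m \<in> mons n d \<Longrightarrow> single m c \<in> R_deg n d"
  by (simp add: R_deg_iff)

lemma perm_pol_in_R_deg:
  fixes p :: "'k::field mpol"
  assumes "\<sigma> permutes {..<n}" "p \<in> R_deg n d"
  shows "perm_pol \<sigma> p \<in> R_deg n d"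
  unfolding perm_pol_def using assms
  by (intro pol.subspace_sum[OF subspace_R_deg] single_in_R_deg perm_mon_in_mons) (auto simp: R_deg_iff)

lemma times_eq_sum:
  fixes p q :: "'k::comm_ring_1 mpol"
  shows "p * q = (\<Sum>a\<in>keys p. \<Sum>b\<in>keys q. single (a + b) (lookup p a * lookup q b))"
proof -
  have "p * q = (\<Sum>a\<in>keys p. single a (lookup p a)) * (\<Sum>b\<in>keys q. single b (lookup q b))"
    by (simp only: sum_single_lookup)
  then show ?thesis
    by (simp add: sum_product mult_single)
qed

subsection \<open>Contraction\<close>

text \<open>The duality between polynomials and coefficient functions. The second argument is an
  arbitrary function on monomials, so that shifts and permutations of it are plain lambda
  terms.\<close>

definition pairing :: "'k::comm_ring_1 mpol \<Rightarrow> (mon \<Rightarrow> 'k) \<Rightarrow> 'k" where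
  "pairing u c = (\<Sum>m\<in>keys u. lookup u m * c m)"

lemma pairing_superset:
  assumes "finite A" "keys u \<subseteq> A"
  shows "pairing u c = (\<Sum>m\<in>A. lookup u m * c m)"
  unfolding pairing_def
  using sum_keys_superset[OF assms, of "\<lambda>m x. x * c m"] by simp

lemma pairing_0 [simp]: "pairing 0 c = 0"
  by (simp add: pairing_def)

lemma pairing_add [simp]: "pairing (u + v) c = pairing u c + pairing v c"
proof -
  let ?A = "keys u \<union> keys v"
  have "finite ?A" by simp
  then show ?thesis
    using keys_add[of u v] pairing_superset[of ?A u] pairing_superset[of ?A v]
      pairing_superset[of ?A "u + v"]
    by (simp add: lookup_add distrib_right sum.distrib)
qed

lemma pairing_diff [simp]: "pairing (u - v) c = pairing u c - pairing v c"
  by (metis pairing_add add_diff_cancel_right' diff_add_cancel)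

lemma pairing_single [simp]: "pairing (single m a) c = a * c m"
  by (cases "a = 0") (auto simp: pairing_def)

lemma pairing_pscale [simp]: "pairing (pscale a u) c = a * pairing u c"
  using pairing_superset[OF _ keys_pscale[of a u], of c]
  by (simp add: pairing_def sum_distrib_left mult.assoc)

lemma pairing_sum [simp]: "pairing (sum g A) c = (\<Sum>a\<in>A. pairing (g a) c)"
  by (induction A rule: infinite_finite_induct) auto

lemma pairing_add_right: "pairing u (\<lambda>m. c m + c' m) = pairing u c + pairing u c'"
  by (simp add: pairing_def distrib_left sum.distrib)

lemma pairing_perm_pol: "pairing (perm_pol \<sigma> u) c = pairing u (\<lambda>m. c (perm_mon \<sigma> m))"
  by (simp add: perm_pol_def) (simp add: pairing_def)

text \<open>Multiplication by a monomial is adjoint to a shift of the coefficient function.\<close>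

lemma pairing_times: "pairing (p * q) c = pairing p (\<lambda>a. pairing q (\<lambda>b. c (a + b)))"
  by (simp add: times_eq_sum) (simp add: pairing_def sum_distrib_left mult.assoc)

text \<open>Contraction is pairing with a shifted coefficient function. The properties of
  \<open>contract\<close> below are obtained by reading coefficients through this formula.\<close>

lemma lookup_contract: "lookup (contract f w) e = pairing f (\<lambda>m. lookup w (m + e))"
proof -
  have "(\<Sum>e'\<in>keys w. lookup (if \<forall>i. lookup m i \<le> lookup e' i
           then single (e' - m) (lookup f m * lookup w e') else 0) e)
      = lookup f m * lookup w (m + e)" for m
  proof -
    \<comment> \<open>Subtraction of exponents is truncated, so the divisibility condition is what
      makes \<open>e' - m = e\<close> solvable only by \<open>m + e\<close>.\<close>
    have *: "((\<forall>i. lookup m i \<le> lookup e' i) \<and> e' - m = e) \<longleftrightarrow> e' = m + e" for e'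
      by (metis add.commute add_diff_cancel_right' le_add1 le_add_diff_inverse lookup_add lookup_minus
          poly_mapping_eqI)
    have "(\<Sum>e'\<in>keys w. lookup (if \<forall>i. lookup m i \<le> lookup e' i
           then single (e' - m) (lookup f m * lookup w e') else 0) e)
       = (\<Sum>e'\<in>keys w. if e' = m + e then lookup f m * lookup w e' else 0)"
      using * by (intro sum.cong refl) (auto simp: lookup_single when_def)
    then show ?thesis
      by (simp add: in_keys_iff)
  qed
  then show ?thesis
    by (simp add: contract_def pairing_def lookup_sum)
qed

text \<open>A product acts by acting twice: the inner pairings are the coefficients of
  \<open>contract g w\<close> at \<open>a + e\<close>, which vanish.\<close>

lemma contract_times_eq_0:
  assumes "contract g w = 0"
  shows "contract (q * g) w = 0"
proof (rule poly_mapping_eqI)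
  fix e
  have "pairing g (\<lambda>b. lookup w (a + b + e)) = 0" for a
    using arg_cong[OF assms, of "\<lambda>p. lookup p (a + e)"] by (simp add: lookup_contract ac_simps)
  then show "lookup (contract (q * g) w) e = lookup 0 e"
    by (simp add: lookup_contract pairing_times) (simp add: pairing_def)
qed

lemma contract_homogeneous:
  assumes "u \<in> R_deg n d" "keys w \<subseteq> mons n d"
  shows "contract u w = single 0 (pairing u (lookup w))"
proof (rule poly_mapping_eqI)
  fix e
  show "lookup (contract u w) e = lookup (single 0 (pairing u (lookup w))) e"
  proof (cases "e = 0")
    case False
    have "lookup w (m + e) = 0" if "m \<in> keys u" for m
    proof -
      have "mdeg (m + e) \<noteq> d"
        using that assms(1) False by (auto simp: R_deg_iff mons_def mdeg_eq_0_iff)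
      then show ?thesis
        using assms(2) by (auto simp: mons_def in_keys_iff)
    qed
    then show ?thesis
      using False by (simp add: lookup_contract lookup_single) (simp add: pairing_def)
  qed (simp add: lookup_contract)
qed

subsection \<open>The Reynolds operator\<close>

lemma reynolds_add [simp]: "reynolds n (p + q) = reynolds n p + reynolds n q"
  by (simp add: reynolds_def sum.distrib pol.scale_right_distrib)

lemma reynolds_0 [simp]: "reynolds n 0 = 0"
  by (simp add: reynolds_def)

lemma reynolds_pscale [simp]: "reynolds n (pscale c p) = pscale c (reynolds n p)"
  by (simp add: reynolds_def mult.commute flip: pol.scale_sum_right)

lemma reynolds_diff [simp]: "reynolds n (p - q) = reynolds n p - reynolds n q"
  by (simp add: reynolds_def sum_subtractf pol.scale_right_diff_distrib)

lemma reynolds_sum [simp]: "reynolds n (sum g A) = (\<Sum>a\<in>A. reynolds n (g a))"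
  by (induction A rule: infinite_finite_induct) auto

lemma reynolds_perm_pol:
  assumes "\<pi> permutes {..<n}" shows "reynolds n (perm_pol \<pi> p) = reynolds n p"
proof -
  have "(\<Sum>\<sigma> | \<sigma> permutes {..<n}. perm_pol \<sigma> (perm_pol \<pi> p))
      = (\<Sum>\<sigma> | \<sigma> permutes {..<n}. perm_pol (\<sigma> \<circ> \<pi>) p)"
    by (intro sum.cong refl) (simp add: perm_pol_comp[OF _ assms])
  also have "\<dots> = (\<Sum>\<sigma> | \<sigma> permutes {..<n}. perm_pol \<sigma> p)"
    by (rule sum_permutations_compose_right[OF assms, symmetric])
  finally show ?thesis by (simp add: reynolds_def)
qed

text \<open>For c constant on orbits the n! permuted copies of u have the same pairing, and the
  normalising factor cancels their number. This is where n! must be invertible in k.\<close>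

lemma pairing_reynolds:
  assumes "of_nat (fact n) \<noteq> (0 :: 'k::field)"
    and "\<And>\<sigma> m. \<sigma> permutes {..<n} \<Longrightarrow> c (perm_mon \<sigma> m) = c m"
  shows "pairing (reynolds n u) c = pairing (u :: 'k mpol) c"
proof -
  have "pairing (\<Sum>\<sigma> | \<sigma> permutes {..<n}. perm_pol \<sigma> u) c = of_nat (fact n) * pairing u c"
    using assms(2) by (simp add: pairing_perm_pol card_permutations[of "{..<n}" n])
  then show ?thesis
    using assms(1) by (simp add: reynolds_def)
qed

subsection \<open>Monomials congruent modulo a symmetric subspace\<close>

text \<open>Instantiated both with the span of the orbit of V, where permutations act, and with the
  ideal it generates, where variables act by multiplication.\<close>

locale poly_subspace =
  fixes J :: "'k::field mpol set"
  assumes subspace: "pol.subspace J"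
begin

definition mcong :: "mon \<Rightarrow> mon \<Rightarrow> bool" where
  "mcong m m' \<longleftrightarrow> single m 1 - single m' 1 \<in> J"

lemma mcong_refl [simp]: "mcong m m"
  by (simp add: mcong_def pol.subspace_0[OF subspace])

lemma mcong_sym: "mcong m m' \<Longrightarrow> mcong m' m"
  using pol.subspace_neg[OF subspace] by (fastforce simp: mcong_def)

lemma mcong_trans [trans]: "mcong m m' \<Longrightarrow> mcong m' m'' \<Longrightarrow> mcong m m''"
  using pol.subspace_add[OF subspace, of "single m 1 - single m' 1" "single m' 1 - single m'' 1"]
  by (simp add: mcong_def)

lemma mcong_single:
  assumes "mcong m m'" shows "single m c - single m' c \<in> J"
proof -
  have "single m c - single m' c = pscale c (single m 1 - single m' 1)"
    by (simp add: pol.scale_right_diff_distrib pscale_single)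
  then show ?thesis
    using assms pol.subspace_scale[OF subspace] by (simp add: mcong_def)
qed

lemma mcong_mem:
  assumes "mcong m m'" "single m' 1 \<in> J" shows "single m c \<in> J"
proof -
  have "single m c = single m c - single m' c + pscale c (single m' 1)"
    by (simp add: pscale_single)
  then show ?thesis
    using mcong_single[OF assms(1), of c] assms(2)
    by (metis pol.subspace_add[OF subspace] pol.subspace_scale[OF subspace])
qed

end

text \<open>A permutation matching the two cofactors exists by equality of types. The images of i
  and j can then be corrected by transpositions that avoid the support of g'.\<close>

lemma obtain_perm_pointed:
  assumes "i \<noteq> j" "i < n" "j < n" "i \<notin> keys g" "j \<notin> keys g" "keys g \<subseteq> {..<n}"
    and "i' \<noteq> j'" "i' < n" "j' < n" "i' \<notin> keys g'" "j' \<notin> keys g'" "keys g' \<subseteq> {..<n}"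
    and "mtype g = mtype g'"
  obtains \<rho> where "\<rho> permutes {..<n}" "\<rho> i = i'" "\<rho> j = j'" "perm_mon \<rho> g = g'"
proof -
  obtain \<pi> where \<pi>: "\<pi> permutes {..<n}" "g' = perm_mon \<pi> g"
    using mtype_eq_imp_perm assms(6,12,13) by metis
  have keys: "\<pi> x \<in> keys g' \<longleftrightarrow> x \<in> keys g" for x
    using permutes_inj[OF \<pi>(1)] by (auto simp: \<pi>(2) keys_perm_mon[OF \<pi>(1)] inj_image_mem_iff)
  \<comment> \<open>\<open>t1\<close> puts the image of i at \<open>i'\<close>, and
    \<open>t2\<close> then puts that of j at \<open>j'\<close>; the latter fixes \<open>i'\<close>
    because both of its points differ from it.\<close>
  define t1 where "t1 = Transposition.transpose (\<pi> i) i'"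
  define j1 where "j1 = t1 (\<pi> j)"
  define t2 where "t2 = Transposition.transpose j1 j'"
  have lt: "\<pi> i < n" "\<pi> j < n"
    using permutes_in_image[OF \<pi>(1)] assms(2,3) by auto
  have t1: "t1 permutes {..<n}"
    unfolding t1_def using lt assms by (intro permutes_swap_id) auto
  have j1: "j1 < n"
    using permutes_in_image[OF t1] lt by (auto simp: j1_def)
  have t2: "t2 permutes {..<n}"
    unfolding t2_def using j1 assms by (intro permutes_swap_id) auto
  have j1_ne: "j1 \<noteq> i'"
    using assms(1) inj_eq[OF permutes_inj[OF \<pi>(1)], of j i]
    by (auto simp: j1_def t1_def transpose_eq_iff)
  have j1_notin: "j1 \<notin> keys g'"
    using assms keys by (auto simp: j1_def t1_def Transposition.transpose_def)
  have t1g: "perm_mon t1 g' = g'"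
    using assms keys by (intro perm_mon_fix) (auto simp: t1_def Transposition.transpose_def)
  have t2g: "perm_mon t2 g' = g'"
    using assms j1_notin by (intro perm_mon_fix) (auto simp: t2_def Transposition.transpose_def)
  show ?thesis
  proof
    show perm: "t2 \<circ> (t1 \<circ> \<pi>) permutes {..<n}"
      by (intro permutes_compose \<pi> t1 t2)
    show "(t2 \<circ> (t1 \<circ> \<pi>)) i = i'"
      using j1_ne assms(7) by (simp add: t1_def t2_def Transposition.transpose_def)
    show "(t2 \<circ> (t1 \<circ> \<pi>)) j = j'"
      by (simp add: t2_def flip: j1_def)
    show "perm_mon (t2 \<circ> (t1 \<circ> \<pi>)) g = g'"
      by (simp only: perm_mon_comp[OF t2 permutes_compose[OF \<pi>(1) t1], symmetric]
          perm_mon_comp[OF t1 \<pi>(1), symmetric] \<pi>(2)[symmetric] t1g t2g)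
  qed
qed

locale sym_subspace = poly_subspace J for J :: "'k::field mpol set" +
  fixes n :: nat
  assumes perm_pol_in: "\<sigma> permutes {..<n} \<Longrightarrow> p \<in> J \<Longrightarrow> perm_pol \<sigma> p \<in> J"
begin

lemma mcong_perm:
  assumes "mcong m m'" "\<sigma> permutes {..<n}"
  shows "mcong (perm_mon \<sigma> m) (perm_mon \<sigma> m')"
  using perm_pol_in[OF assms(2), of "single m 1 - single m' 1"] assms(1) by (simp add: mcong_def)

text \<open>A single binomial yields a single congruence; stability under permutations spreads it to
  every placement of the same exponent and the same type of cofactor.\<close>

lemma mcong_move_exponent:
  assumes "mcong (single i a + g) (single j a + g)"
    and "i \<noteq> j" "i < n" "j < n" "i \<notin> keys g" "j \<notin> keys g" "keys g \<subseteq> {..<n}"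
    and "i' \<noteq> j'" "i' < n" "j' < n" "i' \<notin> keys g'" "j' \<notin> keys g'" "keys g' \<subseteq> {..<n}"
    and "mtype g = mtype g'"
  shows "mcong (single i' a + g') (single j' a + g')"
proof -
  obtain \<rho> where \<rho>: "\<rho> permutes {..<n}" "\<rho> i = i'" "\<rho> j = j'" "perm_mon \<rho> g = g'"
    using obtain_perm_pointed[OF assms(2-)] .
  then show ?thesis
    using mcong_perm[OF assms(1) \<rho>(1)] by (simp add: perm_mon_plus[OF \<rho>(1)])
qed

text \<open>Exponents can be interchanged once they can be moved to unused variables, because
  $(i\,j) = (j\,k)(i\,j)(i\,k)$.\<close>

lemma mcong_transpose:
  assumes move: "\<And>i j a g. i \<noteq> j \<Longrightarrow> i < n \<Longrightarrow> j < n \<Longrightarrow> i \<notin> keys g \<Longrightarrow> j \<notin> keys g \<Longrightarrow>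
      keys g \<subseteq> {..<n} \<Longrightarrow> a > 0 \<Longrightarrow> mtype (single i a + g) = \<mu> \<Longrightarrow>
      mcong (single i a + g) (single j a + g)"
    and "size \<mu> < n" and m: "keys m \<subseteq> {..<n}" "mtype m = \<mu>" and ij: "i < n" "j < n"
  shows "mcong m (perm_mon (Transposition.transpose i j) m)"
proof -
  have half: "mcong m (perm_mon (Transposition.transpose i j) m)"
    if "keys m \<subseteq> {..<n}" "mtype m = \<mu>" "i \<in> keys m" "j \<notin> keys m" "j < n" for m i j
  proof -
    define g where "g = m - single i (lookup m i)"
    have m_eq: "m = single i (lookup m i) + g"
      unfolding g_def using monomial_split(1)[OF that(3)] by simp
    have i: "i \<notin> keys g"
      by (simp add: g_def in_keys_iff lookup_minus)
    have keys_g: "keys m = insert i (keys g)"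
      using that(3) by (subst m_eq) (auto simp: keys_plus_mon in_keys_iff)
    have t: "Transposition.transpose i j permutes {..<n}"
      using that by (intro permutes_swap_id) auto
    have g: "perm_mon (Transposition.transpose i j) g = g"
      using that keys_g i by (intro perm_mon_fix) (auto simp: Transposition.transpose_def)
    have "mcong (single i (lookup m i) + g) (single j (lookup m i) + g)"
      using that keys_g i m_eq by (intro move) (auto simp: in_keys_iff)
    also have "single j (lookup m i) + g = perm_mon (Transposition.transpose i j) m"
      by (subst (2) m_eq) (simp add: perm_mon_plus[OF t] g)
    finally show ?thesis
      by (simp flip: m_eq)
  qed
  consider "i = j" | "i \<notin> keys m" "j \<notin> keys m" | "i \<in> keys m" "j \<notin> keys m"
    | "i \<notin> keys m" "j \<in> keys m" | "i \<noteq> j" "i \<in> keys m" "j \<in> keys m"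
    by blast
  then show ?thesis
  proof cases
    case 2
    then have "perm_mon (Transposition.transpose i j) m = m"
      by (intro perm_mon_fix) (auto simp: Transposition.transpose_def)
    then show ?thesis by simp
  next
    case 3
    then show ?thesis using half m ij by blast
  next
    case 4
    then show ?thesis using half[OF m, of j i] ij by (simp add: transpose_commute)
  next
    case 5
    \<comment> \<open>Both variables occur, so a variable k absent from m serves as temporary
      storage.\<close>
    have "card (keys m) < card {..<n}"
      using m \<open>size \<mu> < n\<close> by (auto simp: size_mtype)
    then obtain k where k: "k < n" "k \<notin> keys m"
      by (metis card_mono finite_keys lessThan_iff not_le subsetI)
    \<comment> \<open>Each transposition is written with its occupied variable first, as
      \<open>half\<close> requires: s1 moves the exponent of i to k, s2 that of j to i, and s3 the
      stored one from k to j.\<close>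
    define s1 s2 s3 where "s1 = Transposition.transpose i k"
      and "s2 = Transposition.transpose j i" and "s3 = Transposition.transpose k j"
    have s: "s1 permutes {..<n}" "s2 permutes {..<n}" "s3 permutes {..<n}"
      unfolding s1_def s2_def s3_def using k ij by (auto intro!: permutes_swap_id)
    have ne: "k \<noteq> i" "k \<noteq> j"
      using k 5 by auto
    define m1 where "m1 = perm_mon s1 m"
    define m2 where "m2 = perm_mon s2 m1"
    have keys1: "x \<in> keys m1 \<longleftrightarrow> s1 x \<in> keys m" for x
      using s(1) by (auto simp: m1_def keys_perm_mon s1_def image_iff) (metis transpose_involutory)
    have keys2: "x \<in> keys m2 \<longleftrightarrow> s1 (s2 x) \<in> keys m" for x
      using s(2) by (auto simp: m2_def keys_perm_mon s2_def image_iff simp flip: keys1) (metis transpose_involutory)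
    have m1: "keys m1 \<subseteq> {..<n}" "mtype m1 = \<mu>"
      using s perm_mon_in_mons[OF s(1), of m "mdeg m"] m by (auto simp: m1_def mons_def)
    have m2: "keys m2 \<subseteq> {..<n}" "mtype m2 = \<mu>"
      using s perm_mon_in_mons[OF s(2), of m1 "mdeg m1"] m1 by (auto simp: m2_def mons_def)
    have "mcong m m1"
      unfolding m1_def s1_def by (rule half[OF m]) (use 5 k in auto)
    also have "mcong m1 m2"
      unfolding m2_def s2_def
      by (rule half[OF m1]) (use 5 k ij ne in \<open>auto simp: keys1 s1_def Transposition.transpose_def\<close>)
    also have "mcong m2 (perm_mon s3 m2)"
      unfolding s3_def
      by (rule half[OF m2]) (use 5 k ij ne in \<open>auto simp: keys2 s1_def s2_def Transposition.transpose_def\<close>)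
    also have "perm_mon s3 m2 = perm_mon (s3 \<circ> (s2 \<circ> s1)) m"
      by (simp only: m1_def m2_def perm_mon_comp[OF s(2,1)] perm_mon_comp[OF s(3) permutes_compose[OF s(1,2)]])
    also have "s3 \<circ> (s2 \<circ> s1) = Transposition.transpose i j"
    proof
      fix x
      show "(s3 \<circ> (s2 \<circ> s1)) x = Transposition.transpose i j x"
        using ne \<open>i \<noteq> j\<close> unfolding s1_def s2_def s3_def o_apply
        by (cases "x = i"; cases "x = j"; cases "x = k") (simp_all add: Transposition.transpose_def)
    qed
    finally show ?thesis .
  qed simp
qed

text \<open>A permutation carrying m to m' is a product of transpositions, and all intermediate
  monomials keep the type \<mu>, so \<open>mcong_transpose\<close> applies to each factor.\<close>

lemma mcong_same_type:
  assumes move: "\<And>i j a g. i \<noteq> j \<Longrightarrow> i < n \<Longrightarrow> j < n \<Longrightarrow> i \<notin> keys g \<Longrightarrow> j \<notin> keys g \<Longrightarrow>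
      keys g \<subseteq> {..<n} \<Longrightarrow> a > 0 \<Longrightarrow> mtype (single i a + g) = \<mu> \<Longrightarrow>
      mcong (single i a + g) (single j a + g)"
    and "size \<mu> < n" and m: "keys m \<subseteq> {..<n}" "mtype m = \<mu>" and m': "keys m' \<subseteq> {..<n}" "mtype m' = \<mu>"
  shows "mcong m m'"
proof -
  obtain \<sigma> where \<sigma>: "\<sigma> permutes {..<n}" "m' = perm_mon \<sigma> m"
    using mtype_eq_imp_perm m m' by metis
  have "mcong m (perm_mon \<sigma> m)"
    using \<sigma>(1) finite_lessThan
  proof (induction \<sigma> rule: permutes_induct)
    case id
    show ?case by (simp only: perm_mon_id mcong_refl)
  next
    case (swap i j p)
    have "perm_mon p m \<in> mons n (mdeg m)"
      using perm_mon_in_mons[OF swap(4), of m "mdeg m"] m(1) by (simp add: mons_def)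
    then have keys: "keys (perm_mon p m) \<subseteq> {..<n}"
      by (simp add: mons_def)
    have t: "Transposition.transpose i j permutes {..<n}"
      using swap by (intro permutes_swap_id) auto
    have "mcong (perm_mon p m) (perm_mon (Transposition.transpose i j) (perm_mon p m))"
      using swap m by (intro mcong_transpose[OF move \<open>size \<mu> < n\<close> keys]) auto
    then show ?case
      unfolding perm_mon_comp[OF t swap(4)] by (rule mcong_trans[OF swap.IH])
  qed
  then show ?thesis by (simp add: \<sigma>)
qed

end

subsection \<open>The binomial construction\<close>

lemma lookup_mon_gcd: "lookup (mon_gcd m m') i = min (lookup m i) (lookup m' i)"
  by (simp add: mon_gcd_def lookup_sum lookup_single when_def in_keys_iff)

lemma mon_gcd_add_diff: "mon_gcd m m' + (m - mon_gcd m m') = m" "mon_gcd m m' + (m' - mon_gcd m m') = m'"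
  by (auto intro!: poly_mapping_eqI simp: lookup_add lookup_minus lookup_mon_gcd)

text \<open>The consequence of having b(\<mu>, \<mu> - {a}) among the summands, freed from the
  choice of binomials. X will be the set of variables of h_alpha; disjointness from it is recorded
  for the count of variables in \<open>is_f_alpha_large\<close>.\<close>

definition exchangeable :: "nat \<Rightarrow> nat set \<Rightarrow> 'k::field mpol \<Rightarrow> nat multiset \<Rightarrow> nat \<Rightarrow> bool" where
  "exchangeable n X f \<mu> a \<longleftrightarrow>
     (\<exists>i j g. i \<noteq> j \<and> i < n \<and> j < n \<and> i \<notin> keys g \<and> j \<notin> keys g \<and> keys g \<subseteq> {..<n} \<and>
        mtype g = \<mu> - {#a#} \<and> insert i (insert j (keys g)) \<inter> X = {} \<and>
        f - perm_pol (Transposition.transpose i j) f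
          = pscale 2 (single (single i a + g) 1 - single (single j a + g) 1))"

text \<open>A summand $b(\lambda, \lambda \setminus \{a\})$ has the form $x_i^a g - x_j^a g$; interchanging
  $x_i$ and $x_j$ changes its sign and fixes the rest of $f_\alpha$.\<close>

lemma is_f_alpha_cases:
  fixes f :: "'k::field mpol"
  assumes "is_f_alpha n d ord \<alpha> f"
  obtains \<tau> b where "\<tau> \<in> partitions d" "\<alpha> \<tau> \<noteq> 0"
    and "\<And>\<mu> \<gamma>. \<mu> \<in> partitions d - {\<tau>} \<Longrightarrow> \<gamma> \<subset># \<mu> \<Longrightarrow>
        fst (b \<mu> \<gamma>) \<in> mons n d \<and> mtype (fst (b \<mu> \<gamma>)) = \<mu> \<and>
        snd (b \<mu> \<gamma>) \<in> mons n d \<and> mtype (snd (b \<mu> \<gamma>)) = \<mu>"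
    and "f = h_pol d \<alpha> + (\<Sum>\<mu>\<in>partitions d - {\<tau>}. \<Sum>\<gamma> | \<gamma> \<subset># \<mu>. bin_pol (b \<mu> \<gamma>))"
    and "\<And>\<mu> a. \<mu> \<in> partitions d - {\<tau>} \<Longrightarrow> a \<in># \<mu> \<Longrightarrow>
        exchangeable n (vars (h_pol d \<alpha>)) f \<mu> a"
proof -
  from assms[unfolded is_f_alpha_def] obtain \<tau> b where \<tau>: "\<tau> \<in> partitions d" "\<alpha> \<tau> \<noteq> 0"
    and b_all: "\<forall>\<mu>\<in>partitions d - {\<tau>}. \<forall>\<gamma>. \<gamma> \<subset># \<mu> \<longrightarrow>
              is_binomial n \<mu> (b \<mu> \<gamma>) \<and> bin_admissible (b \<mu> \<gamma>)
            \<and> mon_has_type n \<gamma> (bin_gcd (b \<mu> \<gamma>))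
            \<and> bin_vars (b \<mu> \<gamma>) \<inter> vars (h_pol d \<alpha>) = {}"
    and disj_all: "\<forall>\<mu>\<in>partitions d - {\<tau>}. \<forall>\<gamma>. \<gamma> \<subset># \<mu> \<longrightarrow>
            (\<forall>\<mu>'\<in>partitions d - {\<tau>}. \<forall>\<gamma>'. \<gamma>' \<subset># \<mu>' \<longrightarrow> (\<mu>, \<gamma>) \<noteq> (\<mu>', \<gamma>') \<longrightarrow>
              bin_vars (b \<mu> \<gamma>) \<inter> bin_vars (b \<mu>' \<gamma>') = {})"
    and f: "f = h_pol d \<alpha> + (\<Sum>\<mu>\<in>partitions d - {\<tau>}. \<Sum>\<gamma> | \<gamma> \<subset># \<mu>. bin_pol (b \<mu> \<gamma>))"
    by (elim conjE exE) (rule that, assumption+)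
  have b: "is_binomial n \<mu> (b \<mu> \<gamma>) \<and> bin_admissible (b \<mu> \<gamma>)
            \<and> mon_has_type n \<gamma> (bin_gcd (b \<mu> \<gamma>))
            \<and> bin_vars (b \<mu> \<gamma>) \<inter> vars (h_pol d \<alpha>) = {}"
    if "\<mu> \<in> partitions d - {\<tau>}" "\<gamma> \<subset># \<mu>" for \<mu> \<gamma>
    using b_all[rule_format, OF that] .
  have disj: "bin_vars (b \<mu> \<gamma>) \<inter> bin_vars (b \<mu>' \<gamma>') = {}"
    if "\<mu> \<in> partitions d - {\<tau>}" "\<gamma> \<subset># \<mu>" "\<mu>' \<in> partitions d - {\<tau>}" "\<gamma>' \<subset># \<mu>'"
      "(\<mu>, \<gamma>) \<noteq> (\<mu>', \<gamma>')" for \<mu> \<gamma> \<mu>' \<gamma>'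
    using disj_all[rule_format, OF that] .
  \<comment> \<open>Indexing by pairs allows one binomial to be split off from the double
    sum.\<close>
  define K where "K = (SIGMA \<mu>:partitions d - {\<tau>}. {\<gamma>. \<gamma> \<subset># \<mu>})"
  have fin: "finite {\<gamma>. \<gamma> \<subset># \<mu>}" for \<mu> :: "nat multiset"
  proof (rule finite_subset)
    show "{\<gamma>. \<gamma> \<subset># \<mu>} \<subseteq> mset ` {xs. set xs \<subseteq> set_mset \<mu> \<and> length xs \<le> size \<mu>}"
    proof
      fix \<gamma> assume "\<gamma> \<in> {\<gamma>. \<gamma> \<subset># \<mu>}"
      then have \<gamma>: "\<gamma> \<subseteq># \<mu>" by (simp add: subset_mset.less_imp_le)
      obtain xs where "mset xs = \<gamma>" by (metis ex_mset)
      then show "\<gamma> \<in> mset ` {xs. set xs \<subseteq> set_mset \<mu> \<and> length xs \<le> size \<mu>}"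
        using set_mset_mono[OF \<gamma>] size_mset_mono[OF \<gamma>] by (intro image_eqI[of _ _ xs]) auto
    qed
  qed (simp add: finite_lists_length_le)
  have "finite K"
    unfolding K_def by (intro finite_SigmaI fin) simp
  have f_K: "f = h_pol d \<alpha> + (\<Sum>(\<mu>, \<gamma>)\<in>K. bin_pol (b \<mu> \<gamma>))"
    unfolding f K_def by (subst sum.Sigma) (auto simp: fin)
  have type: "fst (b \<mu> \<gamma>) \<in> mons n d \<and> mtype (fst (b \<mu> \<gamma>)) = \<mu> \<and>
        snd (b \<mu> \<gamma>) \<in> mons n d \<and> mtype (snd (b \<mu> \<gamma>)) = \<mu>"
    if \<mu>: "\<mu> \<in> partitions d - {\<tau>}" "\<gamma> \<subset># \<mu>" for \<mu> \<gamma>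
  proof -
    have "0 \<notin># \<mu>" "sum_mset \<mu> = d"
      using \<mu> by (auto simp: partitions_def)
    then show ?thesis
      using b[OF \<mu>] by (auto simp: is_binomial_def mon_has_type_iff mons_def simp flip: sum_mtype)
  qed
  have swap: "exchangeable n (vars (h_pol d \<alpha>)) f \<mu> a"
    if \<mu>: "\<mu> \<in> partitions d - {\<tau>}" and a: "a \<in># \<mu>" for \<mu> a
  proof -
    define \<gamma> where "\<gamma> = \<mu> - {#a#}"
    have \<gamma>: "\<gamma> \<subset># \<mu>" "\<mu> = \<gamma> + {#a#}"
      using a by (auto simp: \<gamma>_def subset_mset_def dest: multi_member_split)
    have z: "0 \<notin># \<mu>" "0 \<notin># \<gamma>" "a > 0"
      using \<mu> a \<gamma>(2) by (auto simp: partitions_def intro: gr0I)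
    define g m m' where "g = bin_gcd (b \<mu> \<gamma>)" and "m = fst (b \<mu> \<gamma>)" and "m' = snd (b \<mu> \<gamma>)"
    note bb = b[OF \<mu> \<gamma>(1)]
    have m_eq: "g + (m - g) = m" "g + (m' - g) = m'"
      by (simp_all add: g_def bin_gcd_def m_def m'_def mon_gcd_add_diff)
    have ne: "m \<noteq> m'" and tm: "mtype m = \<mu>" "mtype m' = \<mu>" "mtype g = \<gamma>"
      and km: "keys m \<subseteq> {..<n}" "keys m' \<subseteq> {..<n}" "keys g \<subseteq> {..<n}"
      and dg: "keys g \<inter> keys (m - g) = {}" "keys g \<inter> keys (m' - g) = {}"
      and dh: "(keys m \<union> keys m') \<inter> vars (h_pol d \<alpha>) = {}"
      using bb z unfolding is_binomial_def bin_admissible_def bin_vars_def g_def m_def m'_def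
      by (auto simp: mon_has_type_iff)
    \<comment> \<open>By admissibility the type of m is the union of \<gamma> and the type of the
      cofactor. The cofactor thus has the one part a and is a pure power.\<close>
    have "mtype (m - g) = {#a#}" "mtype (m' - g) = {#a#}"
      using mtype_plus[OF dg(1)] mtype_plus[OF dg(2)] tm \<gamma>(2) m_eq by simp_all
    then obtain i j where ij: "m - g = single i a" "m' - g = single j a"
      by (metis mtype_eq_single_imp)
    have m1: "m = single i a + g" "m' = single j a + g"
      using m_eq ij by (simp_all add: add.commute)
    have keys_m: "keys m = insert i (keys g)" "keys m' = insert j (keys g)"
      using z by (simp_all add: m1 keys_plus_mon)
    have ijn: "i \<noteq> j" "i < n" "j < n" "i \<notin> keys g" "j \<notin> keys g"
      using ne m1 km keys_m dg ij z by auto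
    define t where "t = Transposition.transpose i j"
    have t: "t permutes {..<n}"
      unfolding t_def using ijn by (intro permutes_swap_id) auto
    have tg: "perm_mon t g = g"
      using ijn by (intro perm_mon_fix) (auto simp: t_def Transposition.transpose_def)
    have tmm: "perm_mon t m = m'" "perm_mon t m' = m"
      by (simp_all add: m1 perm_mon_plus[OF t] tg) (simp_all add: t_def)
    define r where "r = h_pol d \<alpha> + (\<Sum>(\<mu>, \<gamma>)\<in>K - {(\<mu>, \<gamma>)}. bin_pol (b \<mu> \<gamma>))"
    have K: "(\<mu>, \<gamma>) \<in> K"
      using \<mu> \<gamma> by (simp add: K_def)
    have f_r: "f = bin_pol (b \<mu> \<gamma>) + r"
      unfolding f_K r_def using sum.remove[OF \<open>finite K\<close> K, of "\<lambda>(\<mu>, \<gamma>). bin_pol (b \<mu> \<gamma>)"] by simp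
    \<comment> \<open>t moves only i and j, and both occur in this binomial; the other summands live
      on disjoint sets of variables.\<close>
    have fix_t: "perm_pol t p = p" if "vars p \<inter> bin_vars (b \<mu> \<gamma>) = {}" for p :: "'k mpol"
      using that by (intro perm_pol_fix)
        (auto simp: t_def Transposition.transpose_def bin_vars_def keys_m simp flip: m_def m'_def)
    have vars_bin: "vars (bin_pol c :: 'k mpol) \<subseteq> bin_vars c" for c
    proof -
      have "keys (bin_pol c :: 'k mpol) \<subseteq> {fst c, snd c}"
        by (auto simp: bin_pol_def in_keys_iff lookup_minus lookup_single when_def split: if_splits)
      then show ?thesis by (auto simp: vars_def bin_vars_def)
    qed
    have "perm_pol t (h_pol d \<alpha>) = h_pol d \<alpha>"
      using bb by (intro fix_t) auto
    moreover have "perm_pol t (bin_pol (b \<mu>' \<gamma>')) = (bin_pol (b \<mu>' \<gamma>') :: 'k mpol)"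
      if "(\<mu>', \<gamma>') \<in> K - {(\<mu>, \<gamma>)}" for \<mu>' \<gamma>'
      using that disj[OF \<mu> \<gamma>(1), of \<mu>' \<gamma>'] vars_bin[of "b \<mu>' \<gamma>'"]
      by (intro fix_t) (auto simp: K_def)
    ultimately have r: "perm_pol t r = r"
      unfolding r_def by (auto intro!: sum.cong)
    have bin: "bin_pol (b \<mu> \<gamma>) = single m 1 - single m' (1 :: 'k)"
      by (simp add: bin_pol_def m_def m'_def)
    have "pscale 2 p = p + p" for p :: "'k mpol"
      by (intro poly_mapping_eqI) (simp only: lookup_add lookup_pscale mult_2)
    then have "f - perm_pol t f = pscale 2 (single m 1 - single m' 1)"
      unfolding f_r bin perm_pol_add perm_pol_diff perm_pol_single r tmm by (simp add: algebra_simps)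
    then have diff: "f - perm_pol (Transposition.transpose i j) f
        = pscale 2 (single (single i a + g) 1 - single (single j a + g) 1)"
      unfolding t_def m1 .
    have "insert i (insert j (keys g)) \<inter> vars (h_pol d \<alpha>) = {}"
      using dh unfolding keys_m by blast
    with diff show ?thesis
      unfolding exchangeable_def using ijn km(3) tm(3)[unfolded \<gamma>_def] by (intro exI conjI)
  qed
  show ?thesis
    by (rule that[of \<tau> b]) (fact \<tau> f type swap)+
qed

lemma lookup_h_pol:
  assumes "\<mu> \<in> partitions d"
  shows "lookup (h_pol d \<alpha>) (xpow \<mu>) = \<alpha> \<mu>"
proof -
  have "xpow \<nu> = xpow \<mu> \<longleftrightarrow> \<nu> = \<mu>" if "\<nu> \<in> partitions d" for \<nu>
    using that assms by (metis (no_types, lifting) mem_Collect_eq mtype_xpow partitions_def)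
  then have "lookup (h_pol d \<alpha>) (xpow \<mu>) = (\<Sum>\<nu>\<in>partitions d. if \<nu> = \<mu> then \<alpha> \<nu> else 0)"
    unfolding h_pol_def lookup_sum by (intro sum.cong) (auto simp: lookup_single when_def)
  then show ?thesis using assms by simp
qed

lemma vars_h_pol:
  assumes "\<mu> \<in> partitions d" "\<alpha> \<mu> \<noteq> 0"
  shows "{..<size \<mu>} \<subseteq> vars (h_pol d \<alpha>)"
proof -
  have "xpow \<mu> \<in> keys (h_pol d \<alpha>)"
    using assms by (simp add: in_keys_iff lookup_h_pol)
  then have "keys (xpow \<mu>) \<subseteq> vars (h_pol d \<alpha>)"
    by (auto simp: vars_def)
  then show ?thesis
    using assms(1) by (simp add: keys_xpow partitions_def)
qed

lemma partition_one: "partitions 1 = {{#1#}}"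
proof -
  have "\<mu> = {#1#}" if "\<mu> \<in> partitions 1" for \<mu>
  proof -
    have "\<mu> \<noteq> {#}" using that by (auto simp: partitions_def)
    then obtain a where a: "a \<in># \<mu>" by blast
    then obtain \<nu> where \<nu>: "\<mu> = add_mset a \<nu>" by (metis multi_member_split)
    then have "a > 0" "0 \<notin># \<nu>" "a + sum_mset \<nu> = 1"
      using that by (auto simp: partitions_def)
    then have "a = 1" "size \<nu> = 0"
      using size_le_sum_mset[of \<nu>] by linarith+
    then show ?thesis using \<nu> by simp
  qed
  then show ?thesis by (auto simp: partitions_def)
qed

text \<open>The variables of x^\<tau> and of one binomial for \<mu> \<noteq> \<tau> are disjoint, so
  n is at least \<open>size \<tau> + size \<mu> + 1\<close>. If \<tau> is 1^d take \<mu> = (d),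
  otherwise take \<mu> = 1^d and use that \<tau> has a part; both choices give d + 2. For d = 1 the
  variables of h_alpha alone suffice.\<close>

lemma is_f_alpha_large:
  fixes f :: "'k::field mpol"
  assumes "is_f_alpha n d ord \<alpha> f" "d \<ge> 1"
  shows "d \<le> n" and "d \<ge> 2 \<Longrightarrow> d + 2 \<le> n"
proof -
  obtain \<tau> b where \<tau>: "\<tau> \<in> partitions d" "\<alpha> \<tau> \<noteq> 0"
    and swap: "\<And>\<mu> a. \<mu> \<in> partitions d - {\<tau>} \<Longrightarrow> a \<in># \<mu> \<Longrightarrow>
        exchangeable n (vars (h_pol d \<alpha>)) f \<mu> a"
    using is_f_alpha_cases[OF assms(1)] by metis
  have vars: "vars (h_pol d \<alpha>) \<subseteq> {..<n}"
    using assms(1) by (simp add: is_f_alpha_def R_all_def)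
  have bound: "size \<tau> + size \<mu> + 1 \<le> n" if \<mu>: "\<mu> \<in> partitions d" "\<mu> \<noteq> \<tau>" "a \<in># \<mu>" for \<mu> a
  proof -
    obtain i j g where g: "i \<noteq> j" "i < n" "j < n" "i \<notin> keys g" "j \<notin> keys g" "keys g \<subseteq> {..<n}"
      "mtype g = \<mu> - {#a#}" "insert i (insert j (keys g)) \<inter> vars (h_pol d \<alpha>) = {}"
      using swap[of \<mu> a] \<mu> unfolding exchangeable_def by blast
    have "card (keys g) = size \<mu> - 1"
      using g(7) \<mu>(3) by (metis size_mtype size_Diff_singleton)
    moreover have "size \<mu> \<ge> 1"
      using \<mu>(3) by (metis One_nat_def Suc_leI count_greater_zero_iff empty_iff neq0_conv set_mset_empty size_eq_0_iff_empty)
    ultimately have "card (insert i (insert j (keys g))) = size \<mu> + 1"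
      using g by simp
    moreover have "insert i (insert j (keys g)) \<inter> {..<size \<tau>} = {}"
      using g vars_h_pol[where \<alpha> = \<alpha>, OF \<tau>] by blast
    ultimately have "card (insert i (insert j (keys g)) \<union> {..<size \<tau>}) = size \<mu> + 1 + size \<tau>"
      by (subst card_Un_disjoint) auto
    moreover have "insert i (insert j (keys g)) \<union> {..<size \<tau>} \<subseteq> {..<n}"
      using g(2,3,6) vars vars_h_pol[where \<alpha> = \<alpha>, OF \<tau>]
      unfolding lessThan_iff[symmetric] by blast
    ultimately show ?thesis
      using card_mono[of "{..<n}" "insert i (insert j (keys g)) \<union> {..<size \<tau>}"] by simp
  qed
  have size_\<tau>: "size \<tau> \<ge> 1"
    using \<tau>(1) \<open>d \<ge> 1\<close> by (cases \<tau>) (auto simp: partitions_def)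
  show large: "d + 2 \<le> n" if "d \<ge> 2"
  proof (cases "\<tau> = replicate_mset d 1")
    case True
    have "{#d#} \<noteq> \<tau>"
    proof
      assume "{#d#} = \<tau>"
      then have "size {#d#} = size \<tau>" by simp
      then show False using True that by simp
    qed
    then show ?thesis
      using bound[of "{#d#}" d] that True by (simp add: partitions_def)
  next
    case False
    then show ?thesis
      using bound[of "replicate_mset d 1" 1] that size_\<tau> by (simp add: partitions_def)
  qed
  show "d \<le> n"
  proof (cases "d = 1")
    case True
    have "{..<size \<tau>} \<subseteq> {..<n}"
      using vars_h_pol[where \<alpha> = \<alpha>, OF \<tau>] vars by (rule order.trans)
    then show ?thesis
      using size_\<tau> True by simp
  qed (use large \<open>d \<ge> 1\<close> in simp)
qed

text \<open>The hypothesis on 2 is conditional because for n = 1 the field may have characteristic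
  2. Halving happens only for types other than \<tau>, which exist only if d >= 2 and hence n >=
  4.\<close>

lemma (in sym_subspace) mcong_of_f_alpha:
  assumes f: "is_f_alpha n d ord \<alpha> f" "f \<in> J" "d \<ge> 1"
    and two: "n \<ge> 2 \<Longrightarrow> (2 :: 'k) \<noteq> 0"
    and m: "m \<in> mons n d" "m' \<in> mons n d" "mtype m = mtype m'"
  shows "mcong m m'"
proof -
  obtain \<tau> b where \<tau>: "\<tau> \<in> partitions d" "\<alpha> \<tau> \<noteq> 0"
    and b: "\<And>\<mu> \<gamma>. \<mu> \<in> partitions d - {\<tau>} \<Longrightarrow> \<gamma> \<subset># \<mu> \<Longrightarrow>
        fst (b \<mu> \<gamma>) \<in> mons n d \<and> mtype (fst (b \<mu> \<gamma>)) = \<mu> \<and>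
        snd (b \<mu> \<gamma>) \<in> mons n d \<and> mtype (snd (b \<mu> \<gamma>)) = \<mu>"
    and f_eq: "f = h_pol d \<alpha> + (\<Sum>\<mu>\<in>partitions d - {\<tau>}. \<Sum>\<gamma> | \<gamma> \<subset># \<mu>. bin_pol (b \<mu> \<gamma>))"
    and swap: "\<And>\<mu> a. \<mu> \<in> partitions d - {\<tau>} \<Longrightarrow> a \<in># \<mu> \<Longrightarrow>
        exchangeable n (vars (h_pol d \<alpha>)) f \<mu> a"
    by (rule is_f_alpha_cases[OF f(1)]) (rule that, (assumption | blast)+)
  have "d \<le> n" and large: "d \<ge> 2 \<Longrightarrow> d + 2 \<le> n"
    using is_f_alpha_large[OF f(1) f(3)] by auto
  have diff_mem: "f - perm_pol \<sigma> f \<in> J" if "\<sigma> permutes {..<n}" for \<sigma>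
    using f(2) perm_pol_in[OF that] by (intro pol.subspace_diff[OF subspace]) auto
  have other: "mcong m m'"
    if \<mu>: "\<mu> \<in> partitions d" "\<mu> \<noteq> \<tau>" and m: "m \<in> mons n d" "m' \<in> mons n d" "mtype m = \<mu>" "mtype m' = \<mu>"
    for \<mu> m m'
  proof (rule mcong_same_type[where \<mu> = \<mu>])
    have "d \<noteq> 1"
    proof
      assume "d = 1"
      then have "partitions d = {{#1#}}" by (simp only: partition_one)
      then show False using \<mu> \<tau> by simp
    qed
    then have "size \<mu> < n" "n \<ge> 2"
      using size_partition[OF \<mu>(1)] large f(3) by auto
    then show "size \<mu> < n" by simp
    fix i' j' a g'
    assume g': "i' \<noteq> j'" "i' < n" "j' < n" "i' \<notin> keys g'" "j' \<notin> keys g'" "keys g' \<subseteq> {..<n}"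
      "a > 0" "mtype (single i' a + g') = \<mu>"
    have \<mu>_eq: "\<mu> = {#a#} + mtype g'"
      using g' mtype_plus[of "single i' a" g'] by (simp add: mtype_single)
    then obtain i j g where g: "i \<noteq> j" "i < n" "j < n" "i \<notin> keys g" "j \<notin> keys g" "keys g \<subseteq> {..<n}"
      "mtype g = \<mu> - {#a#}"
      and diff: "f - perm_pol (Transposition.transpose i j) f
            = pscale 2 (single (single i a + g) 1 - single (single j a + g) 1)"
      using swap[of \<mu> a] \<mu> unfolding exchangeable_def by auto
    have "pscale 2 (single (single i a + g) 1 - single (single j a + g) 1) \<in> J"
      using g by (subst diff[symmetric], intro diff_mem permutes_swap_id) auto
    then have "pscale (1 / 2) (pscale 2 (single (single i a + g) 1 - single (single j a + g) 1)) \<in> J"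
      by (rule pol.subspace_scale[OF subspace])
    then have "mcong (single i a + g) (single j a + g)"
      using two \<open>n \<ge> 2\<close> by (simp add: mcong_def)
    then show "mcong (single i' a + g') (single j' a + g')"
      using mcong_move_exponent[OF _ g(1-6) g'(1-6)] g(7) \<mu>_eq by simp
  qed (use m in \<open>auto simp: mons_def\<close>)
  show ?thesis
  proof (cases "mtype m = \<tau>")
    case False
    show ?thesis
      by (rule other[OF mtype_in_partitions[OF m(1)] False m(1,2) refl m(3)[symmetric]])
  next
    case True
    have xpow: "mcong (xpow \<tau>) (perm_mon \<sigma> (xpow \<tau>))" if \<sigma>: "\<sigma> permutes {..<n}" for \<sigma>
    proof -
      \<comment> \<open>The binomials forming B lie in J one by one. For H only the difference H -
        \<sigma> H is placed in J, its monomials being congruent to their permuted copies.\<close>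
      define B where "B = (\<Sum>\<mu>\<in>partitions d - {\<tau>}. \<Sum>\<gamma> | \<gamma> \<subset># \<mu>. bin_pol (b \<mu> \<gamma>) :: 'k mpol)"
      define H where "H = (\<Sum>\<mu>\<in>partitions d - {\<tau>}. single (xpow \<mu>) (\<alpha> \<mu>))"
      have f_eq': "f = single (xpow \<tau>) (\<alpha> \<tau>) + H + B"
        unfolding f_eq B_def H_def h_pol_def by (subst sum.remove[OF _ \<tau>(1)]) auto
      have "B \<in> J"
        unfolding B_def bin_pol_def
        by (intro pol.subspace_sum[OF subspace]) (use b other in \<open>auto simp flip: mcong_def\<close>)
      then have "B - perm_pol \<sigma> B \<in> J"
        using perm_pol_in[OF \<sigma>] by (intro pol.subspace_diff[OF subspace]) auto
      moreover have "H - perm_pol \<sigma> H \<in> J"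
        unfolding H_def perm_pol_sum sum_subtractf[symmetric] perm_pol_single
        using xpow_in_mons[OF _ \<open>d \<le> n\<close>] \<sigma>
        by (intro pol.subspace_sum[OF subspace] mcong_single other)
          (auto simp: mtype_xpow partitions_def)
      ultimately have "f - perm_pol \<sigma> f - (H - perm_pol \<sigma> H) - (B - perm_pol \<sigma> B) \<in> J"
        using diff_mem[OF \<sigma>] by (metis pol.subspace_diff[OF subspace])
      also have "f - perm_pol \<sigma> f - (H - perm_pol \<sigma> H) - (B - perm_pol \<sigma> B)
          = single (xpow \<tau>) (\<alpha> \<tau>) - single (perm_mon \<sigma> (xpow \<tau>)) (\<alpha> \<tau>)"
        by (simp add: f_eq')
      finally have "pscale (1 / \<alpha> \<tau>) (single (xpow \<tau>) (\<alpha> \<tau>) - single (perm_mon \<sigma> (xpow \<tau>)) (\<alpha> \<tau>)) \<in> J"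
        by (rule pol.subspace_scale[OF subspace])
      then show ?thesis
        using \<tau>(2) by (simp add: mcong_def pol.scale_right_diff_distrib pscale_single)
    qed
    have "mcong (xpow \<tau>) m''" if "m'' \<in> mons n d" "mtype m'' = \<tau>" for m''
    proof -
      have "0 \<notin># \<tau>" using \<tau> by (simp add: partitions_def)
      then have "mtype (xpow \<tau>) = mtype m''" by (simp add: mtype_xpow that)
      moreover have "keys (xpow \<tau>) \<subseteq> {..<n}" "keys m'' \<subseteq> {..<n}"
        using that xpow_in_mons[OF \<tau>(1) \<open>d \<le> n\<close>] by (auto simp: mons_def)
      ultimately obtain \<sigma> where "\<sigma> permutes {..<n}" "m'' = perm_mon \<sigma> (xpow \<tau>)"
        by (metis mtype_eq_imp_perm)
      then show ?thesis using xpow by simp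
    qed
    then show ?thesis
      using m True by (metis mcong_sym mcong_trans)
  qed
qed

subsection \<open>The degree above the generators\<close>

lemma mult_single_diff:
  "single i 1 * (single a c - single b c) = single (i + a) c - single (i + b) (c :: 'k::comm_ring_1)"
  by (simp add: right_diff_distrib mult_single)

text \<open>If p occurs, its exponent is moved to a variable k outside m and different from q; d + 2
  variables are enough for such a k. The clause on q lets a second application avoid q without
  bringing p back.\<close>

lemma avoid_variable:
  assumes m: "m \<in> mons n d" and "d + 2 \<le> n" "p < n"
  obtains m' where "m' \<in> mons n d" "mtype m' = mtype m" "p \<notin> keys m'" "q \<notin> keys m \<Longrightarrow> q \<notin> keys m'"
proof (cases "p \<in> keys m")
  case True
  have "card (keys m) \<le> d"
    using m size_partition[of "mtype m" d] by (simp add: size_mtype)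
  then have "card (insert q (keys m)) < card {..<n}"
    using \<open>d + 2 \<le> n\<close> by (simp add: card_insert_if)
  then obtain k where k: "k < n" "k \<notin> insert q (keys m)"
    by (metis card_mono finite.insertI finite_keys lessThan_iff not_le subsetI)
  define t where "t = Transposition.transpose p k"
  have t: "t permutes {..<n}"
    unfolding t_def using \<open>p < n\<close> k by (intro permutes_swap_id) auto
  have keys: "x \<in> keys (perm_mon t m) \<longleftrightarrow> t x \<in> keys m" for x
    by (simp add: in_keys_iff lookup_perm_mon'[OF t]) (simp add: t_def)
  show ?thesis
  proof (rule that[of "perm_mon t m"])
    show "p \<notin> keys (perm_mon t m)"
      using k unfolding keys by (simp add: t_def)
    show "q \<notin> keys (perm_mon t m)" if "q \<notin> keys m"
      using that k True unfolding keys by (auto simp: t_def Transposition.transpose_def)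
  qed (use t m in auto)
qed (use m that in blast)

context poly_subspace
begin

lemma mcong_mult_var:
  assumes "\<And>p. p \<in> J \<Longrightarrow> single (single i 1) 1 * p \<in> J" and "mcong m m'"
  shows "mcong (single i 1 + m) (single i 1 + m')"
  using assms(1)[of "single m 1 - single m' 1"] assms(2) by (simp add: mcong_def mult_single_diff)

text \<open>Modulo binomials, $m$ may be assumed to avoid $x_p$ and $x_q$.  If then $x_k$ divides $m$,
  the monomials $x_p m / x_k$ and $x_q m / x_k$ have the same type.\<close>

lemma mcong_exchange_var:
  assumes mult: "\<And>i p. i < n \<Longrightarrow> p \<in> J \<Longrightarrow> single (single i 1) 1 * p \<in> J"
    and binom: "\<And>m m'. m \<in> mons n d \<Longrightarrow> m' \<in> mons n d \<Longrightarrow> mtype m = mtype m' \<Longrightarrow> mcong m m'"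
    and d: "d \<ge> 1" "d = 1 \<or> d + 2 \<le> n"
    and pq: "p < n" "q < n" and m: "m \<in> mons n d"
  shows "mcong (single p 1 + m) (single q 1 + m)"
proof -
  have mult_var: "mcong (single i 1 + m) (single i 1 + m')" if "i < n" "mcong m m'" for i m m'
    using mult[OF that(1)] that(2) by (rule mcong_mult_var)
  have split: "\<exists>k m0. k \<in> keys m \<and> k < n \<and> keys m0 \<subseteq> keys m \<and> m = single k 1 + m0 \<and> mdeg m0 = d - 1"
    if m: "m \<in> mons n d" for m
  proof -
    have "m \<noteq> 0"
      using m d(1) by (auto simp: mons_def)
    then obtain k where k: "k \<in> keys m" by fastforce
    define m0 where "m0 = m - single k 1"
    have m_eq: "m = single k 1 + m0"
      unfolding m0_def using monomial_split(2)[OF k] by simp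
    then have "keys m0 \<subseteq> keys m" "mdeg m = 1 + mdeg m0"
      by (auto simp: keys_plus_mon)
    then show ?thesis
      using k m m_eq by (intro exI[of _ k] exI[of _ m0]) (auto simp: mons_def)
  qed
  show ?thesis
  proof (cases "d = 1")
    case True
    obtain k m0 where k: "k < n" "m = single k 1 + m0" "mdeg m0 = 0"
      using split[OF m] True by auto
    then have m_eq: "m = single k 1"
      by (simp add: mdeg_eq_0_iff)
    \<comment> \<open>In degree 1 all variables have the same type, so no room for avoiding p and q
      is required: multiply the congruence of x_p and x_q by x_k.\<close>
    have "mcong (single p 1) (single q 1)"
      using pq True by (intro binom) (auto simp: mons_def mtype_single)
    then have "mcong (single k 1 + single p 1) (single k 1 + single q 1)"
      by (rule mult_var[OF k(1)])
    then show ?thesis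
      unfolding m_eq by (simp only: add.commute)
  next
    case False
    then have n: "d + 2 \<le> n" using d by simp
    obtain m1 where m1: "m1 \<in> mons n d" "mtype m1 = mtype m" "p \<notin> keys m1"
      using avoid_variable[OF m n pq(1)] by metis
    \<comment> \<open>The roles are swapped: q is removed while p is the variable kept
      absent.\<close>
    obtain m2 where m2: "m2 \<in> mons n d" "mtype m2 = mtype m1" "q \<notin> keys m2" "p \<notin> keys m2"
      using avoid_variable[OF m1(1) n pq(2), of p] m1(3) by metis
    have mm2: "mcong m m2"
      using binom[OF m m2(1)] m1 m2 by simp
    obtain k m0 where k: "k < n" "keys m0 \<subseteq> keys m2" "m2 = single k 1 + m0" "mdeg m0 = d - 1"
      using split[OF m2(1)] by auto
    have m0: "keys m0 \<subseteq> {..<n}" "p \<notin> keys m0" "q \<notin> keys m0"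
      using k(2) m2 by (auto simp: mons_def)
    have "mcong (single p 1 + m0) (single q 1 + m0)"
      using m0 pq k(4) d(1)
      by (intro binom) (auto simp: mons_def keys_plus_mon mtype_plus mtype_single)
    then have "mcong (single k 1 + (single p 1 + m0)) (single k 1 + (single q 1 + m0))"
      by (rule mult_var[OF k(1)])
    then have "mcong (single p 1 + m2) (single q 1 + m2)"
      unfolding k(3) by (simp only: add.left_commute)
    then show ?thesis
      \<comment> \<open>The chain runs from x_p m to x_p m2, to x_q m2, and back to x_q m.\<close>
      using mult_var[OF pq(1) mm2] mult_var[OF pq(2) mcong_sym[OF mm2]]
      by (metis mcong_trans)
  qed
qed

text \<open>Replacing one factor by variable 0 stays in the same class, and the exponent of variable
  0 grows until it is the whole degree.\<close>

lemma mcong_power_0: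
  assumes exch: "\<And>p q m. p < n \<Longrightarrow> q < n \<Longrightarrow> m \<in> mons n d \<Longrightarrow> mcong (single p 1 + m) (single q 1 + m)"
    and "n > 0" and "m \<in> mons n (Suc d)"
  shows "mcong m (single 0 (Suc d))"
  using assms(3)
proof (induction "Suc d - lookup m 0" arbitrary: m rule: less_induct)
  case less
  show ?case
  proof (cases "keys m \<subseteq> {0}")
    case True
    then have "m = single 0 (lookup m 0)"
      by (intro poly_mapping_eqI) (auto simp: lookup_single when_def in_keys_iff)
    moreover from this have "lookup m 0 = Suc d"
      using less.prems by (metis (mono_tags, lifting) mdeg_single mem_Collect_eq mons_def)
    ultimately show ?thesis by simp
  next
    case False
    then obtain i where i: "i \<in> keys m" "i \<noteq> 0" by auto
    define m0 where "m0 = m - single i 1"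
    have m_eq: "m = single i 1 + m0"
      unfolding m0_def using monomial_split(2)[OF i(1)] by simp
    have m0: "m0 \<in> mons n d" and "i < n"
      using less.prems m_eq i(1) by (auto simp: mons_def keys_plus_mon)
    have "mcong (single 0 1 + m0) (single 0 (Suc d))"
    proof (rule less.hyps)
      show "single 0 1 + m0 \<in> mons n (Suc d)"
        using m0 \<open>n > 0\<close> by (auto simp: mons_def keys_plus_mon)
      have "lookup (single 0 1 + m0) 0 = Suc (lookup m 0)"
        using i(2) by (simp add: m_eq lookup_add lookup_single)
      moreover have "lookup (single 0 1 + m0) 0 \<le> Suc d"
        using lookup_le_mdeg[of "single 0 1 + m0" 0] m0 by (simp add: mons_def)
      ultimately show "Suc d - lookup (single 0 1 + m0) 0 < Suc d - lookup m 0"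
        by simp
    qed
    moreover have "mcong m (single 0 1 + m0)"
      unfolding m_eq using m0 \<open>i < n\<close> \<open>n > 0\<close> by (intro exch) auto
    ultimately show ?thesis by (metis mcong_trans)
  qed
qed

lemma monomials_above_mem:
  assumes mult: "\<And>i p. i < n \<Longrightarrow> p \<in> J \<Longrightarrow> single (single i 1) 1 * p \<in> J"
    and deg_e: "\<And>m c. m \<in> mons n e \<Longrightarrow> single m c \<in> J"
    and "keys m \<subseteq> {..<n}" "mdeg m \<ge> e"
  shows "single m c \<in> J"
  using assms(3,4)
proof (induction "mdeg m - e" arbitrary: m)
  case 0
  then show ?case using deg_e by (simp add: mons_def)
next
  case (Suc k)
  have "m \<noteq> 0" using Suc.hyps(2) by auto
  then obtain i where i: "i \<in> keys m" by fastforce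
  define m0 where "m0 = m - single i 1"
  have m_eq: "m = single i 1 + m0"
    unfolding m0_def using monomial_split(2)[OF i] by simp
  have "mdeg m = Suc (mdeg m0)" by (simp add: m_eq)
  then have "single m0 c \<in> J"
    using Suc.hyps(2) Suc.prems by (intro Suc.hyps(1)) (auto simp: m_eq keys_plus_mon)
  then show ?case
    using mult[of i "single m0 c"] i Suc.prems by (auto simp: m_eq mult_single)
qed

end

subsection \<open>The ideal generated by an orbit\<close>

lemma R_all_0 [simp]: "0 \<in> R_all n"
  by (simp add: R_all_iff)

lemma R_all_add: "p \<in> R_all n \<Longrightarrow> q \<in> R_all n \<Longrightarrow> p + q \<in> R_all n"
  using keys_add[of p q] by (auto simp: R_all_iff)

lemma R_all_sum: "(\<And>a. a \<in> A \<Longrightarrow> g a \<in> R_all n) \<Longrightarrow> sum g A \<in> R_all n"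
  by (induction A rule: infinite_finite_induct) (auto intro: R_all_add)

lemma R_all_times: "p \<in> R_all n \<Longrightarrow> q \<in> R_all n \<Longrightarrow> p * q \<in> R_all n"
  for p q :: "'k::comm_ring_1 mpol"
  using keys_mult[of p q] by (fastforce simp: R_all_iff keys_plus_mon)

lemma R_deg_subset_R_all: "p \<in> R_deg n d \<Longrightarrow> p \<in> R_all n"
  by (simp add: R_deg_def)

lemma single_in_R_all: "keys m \<subseteq> {..<n} \<Longrightarrow> single m c \<in> R_all n"
  by (auto simp: R_all_iff)

lemma sym_ideal_times:
  assumes "p \<in> sym_ideal n V" "h \<in> R_all n"
  shows "h * p \<in> sym_ideal n V"
proof -
  from assms(1) obtain A q where A: "p = (\<Sum>g\<in>A. q g * g)" "finite A"
    "A \<subseteq> {perm_pol \<sigma> f | \<sigma> f. \<sigma> permutes {..<n} \<and> f \<in> V}" "\<forall>g\<in>A. q g \<in> R_all n"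
    unfolding sym_ideal_def by blast
  then have "h * p = (\<Sum>g\<in>A. (h * q g) * g)" "\<forall>g\<in>A. h * q g \<in> R_all n"
    using assms(2) by (auto simp: sum_distrib_left mult.assoc R_all_times)
  then show ?thesis
    unfolding sym_ideal_def using A(2,3)
    by (intro CollectI exI[of _ A] exI[of _ "\<lambda>g. h * q g"] conjI)
qed

lemma perm_pol_in_sym_ideal:
  fixes f :: "'k::comm_ring_1 mpol"
  assumes "\<sigma> permutes {..<n}" "f \<in> V" shows "perm_pol \<sigma> f \<in> sym_ideal n V"
proof -
  have "perm_pol \<sigma> f = (\<Sum>g\<in>{perm_pol \<sigma> f}. 1 * g)" "(1 :: 'k mpol) \<in> R_all n"
    by (simp_all add: R_all_iff)
  then show ?thesis
    unfolding sym_ideal_def using assms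
    by (intro CollectI exI[of _ "{perm_pol \<sigma> f}"] exI[of _ "\<lambda>_. 1"] conjI) auto
qed

lemma sym_ideal_add:
  fixes p p' :: "'k::comm_ring_1 mpol"
  assumes "p \<in> sym_ideal n V" "p' \<in> sym_ideal n V" shows "p + p' \<in> sym_ideal n V"
proof -
  let ?G = "{perm_pol \<sigma> f | \<sigma> f. \<sigma> permutes {..<n} \<and> f \<in> V}"
  from assms obtain A q A' q' where
    A: "p = (\<Sum>g\<in>A. q g * g)" "finite A" "A \<subseteq> ?G" "\<forall>g\<in>A. q g \<in> R_all n" and
    A': "p' = (\<Sum>g\<in>A'. q' g * g)" "finite A'" "A' \<subseteq> ?G" "\<forall>g\<in>A'. q' g \<in> R_all n"
    unfolding sym_ideal_def by blast
  \<comment> \<open>A generator may occur in both sums with different multipliers; extension by 0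
    puts both sums over the union.\<close>
  define h where "h g = (if g \<in> A then q g else 0)" for g
  define h' where "h' g = (if g \<in> A' then q' g else 0)" for g
  have "p = (\<Sum>g\<in>A \<union> A'. h g * g)" "p' = (\<Sum>g\<in>A \<union> A'. h' g * g)"
    unfolding A(1) A'(1) h_def h'_def using A(2) A'(2)
    by (auto intro!: sum.mono_neutral_cong_left)
  then have "p + p' = (\<Sum>g\<in>A \<union> A'. (h g + h' g) * g)"
    by (simp add: sum.distrib distrib_right)
  moreover have "\<forall>g\<in>A \<union> A'. h g + h' g \<in> R_all n"
    using A(4) A'(4) by (auto simp: h_def h'_def intro!: R_all_add)
  moreover have "finite (A \<union> A')" "A \<union> A' \<subseteq> ?G"
    using A A' by auto
  ultimately show ?thesis
    unfolding sym_ideal_def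
    by (intro CollectI exI[of _ "A \<union> A'"] exI[of _ "\<lambda>g. h g + h' g"] conjI)
qed

lemma poly_subspace_sym_ideal: "poly_subspace (sym_ideal n V)"
proof (unfold_locales, rule pol.subspaceI)
  show "0 \<in> sym_ideal n V"
    unfolding sym_ideal_def by (intro CollectI exI[of _ "{}"]) auto
  show "pscale c p \<in> sym_ideal n V" if "p \<in> sym_ideal n V" for c p
    using sym_ideal_times[OF that, of "single 0 c"] by (simp add: pscale_def single_in_R_all)
qed (rule sym_ideal_add)

text \<open>Stability under permutations follows here from linearity and composition of
  permutations, with no appeal to multiplicativity of \<open>perm_pol\<close>.\<close>

lemma sym_subspace_orbit_span:
  "sym_subspace (pol.span {perm_pol \<sigma> f | \<sigma> f. \<sigma> permutes {..<n} \<and> f \<in> V}) n"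
proof unfold_locales
  let ?G = "{perm_pol \<sigma> f | \<sigma> f. \<sigma> permutes {..<n} \<and> f \<in> V}"
  show "pol.subspace (pol.span ?G)" by simp
  fix \<sigma> p assume \<sigma>: "\<sigma> permutes {..<n}" and "p \<in> pol.span ?G"
  from this(2) show "perm_pol \<sigma> p \<in> pol.span ?G"
  proof (induction rule: pol.span_induct_alt)
    case base
    then show ?case by (simp add: pol.span_zero)
  next
    case (step c x y)
    then obtain \<pi> f where "x = perm_pol \<pi> f" "\<pi> permutes {..<n}" "f \<in> V" by blast
    then have "perm_pol \<sigma> x \<in> ?G"
      using \<sigma> by (auto simp: perm_pol_comp intro!: exI[of _ "\<sigma> \<circ> \<pi>"] exI[of _ f] permutes_compose)
    then show ?case
      using step by (simp add: pol.span_add pol.span_scale pol.span_base)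
  qed
qed

lemma sym_ideal_mcong:
  fixes f :: "'k::field mpol"
  assumes "is_f_alpha n d ord \<alpha> f" "f \<in> V" "d \<ge> 1" "n \<ge> 2 \<Longrightarrow> (2 :: 'k) \<noteq> 0"
    and "m \<in> mons n d" "m' \<in> mons n d" "mtype m = mtype m'"
  shows "poly_subspace.mcong (sym_ideal n V) m m'"
proof -
  let ?G = "{perm_pol \<sigma> f | \<sigma> f. \<sigma> permutes {..<n} \<and> f \<in> V}"
  interpret I: poly_subspace "sym_ideal n V" by (rule poly_subspace_sym_ideal)
  interpret J: sym_subspace "pol.span ?G" n by (rule sym_subspace_orbit_span)
  have "f \<in> ?G"
    using assms(2) by (intro CollectI exI[of _ id] exI[of _ f] conjI) (simp_all only: perm_pol_id permutes_id)
  then have "J.mcong m m'"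
    using assms by (intro J.mcong_of_f_alpha[OF assms(1)]) (auto simp: pol.span_base)
  moreover have "pol.span ?G \<subseteq> sym_ideal n V"
    using perm_pol_in_sym_ideal by (intro pol.span_minimal I.subspace) blast
  ultimately show ?thesis
    by (auto simp: I.mcong_def J.mcong_def)
qed

subsection \<open>Invariant elements of the divided power algebra\<close>

lemma lookup_perm_pol:
  assumes "\<sigma> permutes S"
  shows "lookup (perm_pol \<sigma> p) (perm_mon \<sigma> m) = lookup p m"
proof -
  have "perm_mon \<sigma> m' = perm_mon \<sigma> m \<longleftrightarrow> m' = m" for m'
    using lookup_perm_mon[OF permutes_inj[OF assms]] by (metis poly_mapping_eqI)
  then have "lookup (perm_pol \<sigma> p) (perm_mon \<sigma> m) = (\<Sum>m'\<in>keys p. if m' = m then lookup p m' else 0)"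
    unfolding perm_pol_def lookup_sum by (intro sum.cong) (auto simp: lookup_single when_def)
  then show ?thesis
    by (simp add: in_keys_iff)
qed

lemma lookup_S_inv_deg:
  "w \<in> S_inv_deg n j \<Longrightarrow> \<sigma> permutes {..<n} \<Longrightarrow> lookup w (perm_mon \<sigma> m) = lookup w m"
  using lookup_perm_pol[of \<sigma> "{..<n}" w m] by (simp add: S_inv_deg_def)

lemma keys_S_inv_deg: "w \<in> S_inv_deg n (- int d) \<Longrightarrow> keys w \<subseteq> mons n d"
  by (simp add: S_inv_deg_def S_deg_iff)

text \<open>The invariant element of the divided power algebra with prescribed coefficient on each
  type: a vector indexed by partitions, viewed in degree -d.\<close>

definition orbit_sum :: "nat \<Rightarrow> nat \<Rightarrow> (nat multiset \<Rightarrow> 'k) \<Rightarrow> 'k::comm_ring_1 mpol" where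
  "orbit_sum n d c = (\<Sum>m\<in>mons n d. single m (c (mtype m)))"

lemma lookup_orbit_sum: "lookup (orbit_sum n d c) m = (if m \<in> mons n d then c (mtype m) else 0)"
  by (simp add: orbit_sum_def lookup_sum lookup_single when_def)

lemma orbit_sum_in_S_inv_deg: "orbit_sum n d c \<in> S_inv_deg n (- int d)"
proof -
  have "keys (orbit_sum n d c) \<subseteq> mons n d"
    by (auto simp: in_keys_iff lookup_orbit_sum split: if_splits)
  moreover have "perm_pol \<sigma> (orbit_sum n d c) = orbit_sum n d c" if \<sigma>: "\<sigma> permutes {..<n}" for \<sigma>
  proof -
    let ?i = "perm_mon (Hilbert_Choice.inv \<sigma>)"
    note inv = permutes_inv[OF \<sigma>]
    have "perm_pol \<sigma> (orbit_sum n d c) = (\<Sum>m\<in>mons n d. single (perm_mon \<sigma> m) (c (mtype m)))"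
      by (simp add: orbit_sum_def)
    also have "\<dots> = orbit_sum n d c"
      unfolding orbit_sum_def
    proof (rule sum.reindex_bij_witness[of _ ?i "perm_mon \<sigma>"])
      show "?i (perm_mon \<sigma> m) = m" "perm_mon \<sigma> (?i m) = m" for m
        using perm_mon_comp[OF inv \<sigma>, of m] perm_mon_comp[OF \<sigma> inv, of m]
        by (simp_all only: permutes_inv_o[OF \<sigma>] perm_mon_id)
    qed (use \<sigma> inv in auto)
    finally show ?thesis .
  qed
  ultimately show ?thesis
    by (simp add: S_inv_deg_def S_deg_iff)
qed

lemma contract_add_left: "contract (p + q) w = contract p w + contract q w"
  by (intro poly_mapping_eqI) (simp add: lookup_contract lookup_add)

lemma contract_add_right: "contract p (v + w) = contract p v + contract p w"
  by (intro poly_mapping_eqI) (simp add: lookup_contract lookup_add pairing_add_right)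

lemma contract_0_left [simp]: "contract 0 w = 0"
  by (simp add: contract_def)

lemma contract_sum_left: "contract (sum g A) w = (\<Sum>a\<in>A. contract (g a) w)"
  by (induction A rule: infinite_finite_induct) (auto simp: contract_add_left)

lemma contract_S_ge:
  assumes "u \<in> R_deg n d" "s \<in> S_ge n (- int d + 1)"
  shows "contract u s = 0"
proof (rule poly_mapping_eqI)
  fix e
  have "lookup s (m + e) = 0" if "m \<in> keys u" for m
  proof -
    have "mdeg (m + e) \<ge> d"
      using that assms(1) by (auto simp: R_deg_iff mons_def)
    then show ?thesis
      using assms(2) unfolding S_ge_iff by (meson in_keys_iff not_le)
  qed
  then show "lookup (contract u s) e = lookup 0 e"
    by (simp add: lookup_contract pairing_def)
qed

subsection \<open>The characteristic\<close>

lemma of_nat_neq_0_below_CHAR: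
  assumes "CHAR('k::field) > n \<or> CHAR('k) = 0" "0 < k" "k \<le> n"
  shows "of_nat k \<noteq> (0 :: 'k)"
  using assms by (auto simp: of_nat_eq_0_iff_char_dvd dest: dvd_imp_le)

lemma of_nat_fact_neq_0:
  assumes "CHAR('k::field) > n \<or> CHAR('k) = 0"
  shows "of_nat (fact n) \<noteq> (0 :: 'k)"
proof -
  have "of_nat (fact k) \<noteq> (0 :: 'k)" if "k \<le> n" for k
    using that
  proof (induction k)
    case (Suc k)
    then show ?case
      using of_nat_neq_0_below_CHAR[OF assms, of "Suc k"]
      by (simp only: fact_Suc of_nat_mult of_nat_id mult_eq_0_iff) simp
  qed simp
  then show ?thesis by simp
qed

subsection \<open>Linear algebra\<close>

text \<open>The duality principle behind the degree d part of the annihilator: a vector outside a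
  span is detected by a functional that kills the span.\<close>

lemma separating_functional:
  fixes x :: "'k::field mpol"
  assumes "x \<notin> pol.span B"
  obtains \<phi> where "\<And>a b. \<phi> (a + b) = \<phi> a + \<phi> b" "\<And>c a. \<phi> (pscale c a) = c * \<phi> a"
    "\<And>b. b \<in> B \<Longrightarrow> \<phi> b = 0" "\<phi> x = 1"
proof -
  interpret vector_space_pair "pscale :: 'k \<Rightarrow> 'k mpol \<Rightarrow> 'k mpol" "(*) :: 'k \<Rightarrow> 'k \<Rightarrow> 'k"
    by unfold_locales (auto simp: algebra_simps)
  \<comment> \<open>B may be linearly dependent, while values can be prescribed freely only on an
    independent set.\<close>
  obtain C where C: "C \<subseteq> B" "pol.independent C" "B \<subseteq> pol.span C"
    using pol.maximal_independent_subset by blast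
  have "x \<notin> pol.span C"
    using assms C(1) pol.span_mono by blast
  then have ind: "pol.independent (insert x C)"
    using C(2) by (rule pol.independent_insertI)
  obtain g where g: "Vector_Spaces.linear pscale (*) g" "\<forall>y\<in>insert x C. g y = (if y = x then 1 else 0 :: 'k)"
    using linear_independent_extend[OF ind, of "\<lambda>y. if y = x then 1 else 0"] by blast
  interpret g: Vector_Spaces.linear pscale "(*)" g by fact
  have "g b = 0" if "b \<in> B" for b
  proof -
    have "b \<in> pol.span C" using that C by blast
    moreover have "g y = 0" if "y \<in> C" for y
      using g(2) that \<open>x \<notin> pol.span C\<close> pol.span_base by fastforce
    ultimately show ?thesis
      using g.eq_0_on_span by blast
  qed
  then show ?thesis
    using that[of g] g.add g.scale g(2) by auto
qed

lemma linear_image_span: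
  fixes L :: "'k::field mpol \<Rightarrow> 'k mpol"
  assumes add: "\<And>a b. L (a + b) = L a + L b" and scale: "\<And>c a. L (pscale c a) = pscale c (L a)"
  shows "pol.span (L ` pol.span X) = pol.span (L ` X)"
proof
  have L0: "L 0 = 0"
    using scale[of 0 0] by simp
  have "L x \<in> pol.span (L ` X)" if "x \<in> pol.span X" for x
    using that
  proof (induction rule: pol.span_induct_alt)
    case base
    then show ?case by (simp add: L0 pol.span_zero)
  next
    case (step c x y)
    then show ?case
      by (simp add: add scale pol.span_add pol.span_scale pol.span_base)
  qed
  then show "pol.span (L ` pol.span X) \<subseteq> pol.span (L ` X)"
    by (intro pol.span_minimal) auto
  show "pol.span (L ` X) \<subseteq> pol.span (L ` pol.span X)"
    by (intro pol.span_mono image_mono pol.span_superset)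
qed

text \<open>A linear map does not raise dimension, so r is a lower bound for the span of X, and the
  number of generators is an upper bound. It turns the dimension of U into that of V.\<close>

lemma dim_span_of_linear_image:
  fixes L :: "'k::field mpol \<Rightarrow> 'k mpol"
  assumes add: "\<And>a b. L (a + b) = L a + L b" and scale: "\<And>c a. L (pscale c a) = pscale c (L a)"
    and "finite X" "card X \<le> r" "pol.dim (pol.span (L ` X)) = r"
  shows "pol.dim (pol.span X) = r"
proof (rule antisym)
  show "pol.dim (pol.span X) \<le> r"
    using pol.dim_le_card'[OF \<open>finite X\<close>] \<open>card X \<le> r\<close> by simp
  obtain B where B: "B \<subseteq> pol.span X" "pol.independent B" "pol.span X \<subseteq> pol.span B"
    "card B = pol.dim (pol.span X)"
    using pol.basis_exists by blast
  \<comment> \<open>An infinite set has \<open>card\<close> 0, so finiteness must be known before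
    cardinalities are compared.\<close>
  have "finite B"
    using pol.independent_span_bound[OF \<open>finite X\<close> B(2,1)] by simp
  have "pol.span (L ` X) = pol.span (L ` B)"
    using linear_image_span[of L X] linear_image_span[of L B] add scale pol.span_minimal[OF B(1)] B(3)
    by (metis pol.subspace_span subset_antisym)
  then have "r \<le> card (L ` B)"
    using pol.dim_le_card[of "pol.span (L ` X)" "L ` B"] \<open>finite B\<close> assms(5) by simp
  then show "r \<le> pol.dim (pol.span X)"
    using card_image_le[OF \<open>finite B\<close>, of L] B(4) by simp
qed

subsection \<open>Annihilators\<close>

text \<open>The two monomials of each binomial lie in one orbit. Hence \<rho> kills the binomials,
  and any subspace that identifies monomials of equal type contains them, which leaves h_alpha in
  both situations.\<close>

lemma
  fixes f :: "'k::field mpol"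
  assumes f: "is_f_alpha n d ord \<alpha> f" and d: "d \<ge> 1"
  shows f_alpha_in_R_deg: "f \<in> R_deg n d"
    and reynolds_f_alpha: "reynolds n f = (\<Sum>\<mu>\<in>partitions d. pscale (\<alpha> \<mu>) (Msym n \<mu>))"
    and f_alpha_minus_h_pol: "poly_subspace J \<Longrightarrow>
      (\<And>m m'. m \<in> mons n d \<Longrightarrow> m' \<in> mons n d \<Longrightarrow> mtype m = mtype m' \<Longrightarrow> poly_subspace.mcong J m m') \<Longrightarrow>
      f - h_pol d \<alpha> \<in> J"
    and f_alpha_nonzero: "\<exists>\<tau>\<in>partitions d. \<alpha> \<tau> \<noteq> 0"
proof -
  obtain \<tau> b where \<tau>: "\<tau> \<in> partitions d" "\<alpha> \<tau> \<noteq> 0"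
    and b: "\<And>\<mu> \<gamma>. \<mu> \<in> partitions d - {\<tau>} \<Longrightarrow> \<gamma> \<subset># \<mu> \<Longrightarrow>
        fst (b \<mu> \<gamma>) \<in> mons n d \<and> mtype (fst (b \<mu> \<gamma>)) = \<mu> \<and>
        snd (b \<mu> \<gamma>) \<in> mons n d \<and> mtype (snd (b \<mu> \<gamma>)) = \<mu>"
    and f_eq: "f = h_pol d \<alpha> + (\<Sum>\<mu>\<in>partitions d - {\<tau>}. \<Sum>\<gamma> | \<gamma> \<subset># \<mu>. bin_pol (b \<mu> \<gamma>))"
    by (rule is_f_alpha_cases[OF f]) (rule that, (assumption | blast)+)
  have "d \<le> n"
    using is_f_alpha_large[OF f d] by simp
  then have "h_pol d \<alpha> \<in> R_deg n d"
    unfolding h_pol_def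
    by (intro pol.subspace_sum[OF subspace_R_deg] single_in_R_deg xpow_in_mons)
  moreover have "(bin_pol (b \<mu> \<gamma>) :: 'k mpol) \<in> R_deg n d" if "\<mu> \<in> partitions d - {\<tau>}" "\<gamma> \<subset># \<mu>" for \<mu> \<gamma>
    unfolding bin_pol_def using b[OF that]
    by (intro pol.subspace_diff[OF subspace_R_deg] single_in_R_deg) auto
  ultimately show "f \<in> R_deg n d"
    unfolding f_eq by (intro pol.subspace_add[OF subspace_R_deg] pol.subspace_sum[OF subspace_R_deg]) auto
  have "reynolds n (bin_pol (b \<mu> \<gamma>)) = (0 :: 'k mpol)" if "\<mu> \<in> partitions d - {\<tau>}" "\<gamma> \<subset># \<mu>" for \<mu> \<gamma>
  proof -
    have "keys (fst (b \<mu> \<gamma>)) \<subseteq> {..<n}" "keys (snd (b \<mu> \<gamma>)) \<subseteq> {..<n}"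
      "mtype (fst (b \<mu> \<gamma>)) = mtype (snd (b \<mu> \<gamma>))"
      using b[OF that] by (auto simp: mons_def)
    then obtain \<sigma> where \<sigma>: "\<sigma> permutes {..<n}" "snd (b \<mu> \<gamma>) = perm_mon \<sigma> (fst (b \<mu> \<gamma>))"
      by (rule mtype_eq_imp_perm)
    have "reynolds n (single (perm_mon \<sigma> (fst (b \<mu> \<gamma>))) (1 :: 'k)) = reynolds n (single (fst (b \<mu> \<gamma>)) 1)"
      using reynolds_perm_pol[OF \<sigma>(1), of "single (fst (b \<mu> \<gamma>)) (1 :: 'k)"] by simp
    then show ?thesis by (simp add: bin_pol_def \<sigma>(2))
  qed
  moreover have "reynolds n (h_pol d \<alpha>) = (\<Sum>\<mu>\<in>partitions d. pscale (\<alpha> \<mu>) (Msym n \<mu>))"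
    unfolding h_pol_def reynolds_sum Msym_def
    by (intro sum.cong refl) (simp add: pscale_single flip: reynolds_pscale)
  ultimately show "reynolds n f = (\<Sum>\<mu>\<in>partitions d. pscale (\<alpha> \<mu>) (Msym n \<mu>))"
    unfolding f_eq by simp
  show "f - h_pol d \<alpha> \<in> J" if "poly_subspace J"
    and cong: "\<And>m m'. m \<in> mons n d \<Longrightarrow> m' \<in> mons n d \<Longrightarrow> mtype m = mtype m' \<Longrightarrow> poly_subspace.mcong J m m'"
  proof -
    interpret poly_subspace J by fact
    have "(bin_pol (b \<mu> \<gamma>) :: 'k mpol) \<in> J" if "\<mu> \<in> partitions d - {\<tau>}" "\<gamma> \<subset># \<mu>" for \<mu> \<gamma>
      using b[OF that] cong[of "fst (b \<mu> \<gamma>)" "snd (b \<mu> \<gamma>)"] by (simp add: bin_pol_def mcong_def)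
    then show ?thesis
      unfolding f_eq add_diff_cancel_left' by (intro pol.subspace_sum[OF subspace]) auto
  qed
  show "\<exists>\<tau>\<in>partitions d. \<alpha> \<tau> \<noteq> 0" using \<tau> by blast
qed

lemma orbit_sum_in_perp:
  fixes \<alpha> :: "nat \<Rightarrow> nat multiset \<Rightarrow> 'k::field"
  assumes fact: "of_nat (fact n) \<noteq> (0 :: 'k)" and "d \<le> n"
    and U: "U = pol.span ((\<lambda>i. \<Sum>\<mu>\<in>partitions d. pscale (\<alpha> i \<mu>) (Msym n \<mu>)) ` {..<r})" "U \<subseteq> R_deg n d"
    and c: "\<And>i. i < r \<Longrightarrow> (\<Sum>\<mu>\<in>partitions d. \<alpha> i \<mu> * c \<mu>) = 0"
  shows "orbit_sum n d c \<in> perp n d U"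
proof -
  let ?w = "orbit_sum n d c"
  note w = orbit_sum_in_S_inv_deg[of n d c]
  have "pairing (Msym n \<mu>) (lookup ?w) = c \<mu>" if "\<mu> \<in> partitions d" for \<mu>
  proof -
    have "pairing (Msym n \<mu>) (lookup ?w) = pairing (single (xpow \<mu>) 1) (lookup ?w)"
      unfolding Msym_def by (intro pairing_reynolds fact lookup_S_inv_deg[OF w])
    also have "\<dots> = c \<mu>"
      using that xpow_in_mons[OF that \<open>d \<le> n\<close>] by (simp add: lookup_orbit_sum mtype_xpow partitions_def)
    finally show ?thesis .
  qed
  then have gen: "pairing (\<Sum>\<mu>\<in>partitions d. pscale (\<alpha> i \<mu>) (Msym n \<mu>)) (lookup ?w) = 0" if "i < r" for i
    using c[OF that] by simp
  have "pairing u (lookup ?w) = 0" if "u \<in> U" for u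
    using that unfolding U(1)
  proof (induction rule: pol.span_induct_alt)
    case (step a x y)
    then show ?case using gen by auto
  qed simp
  then show ?thesis
    using U(2) w contract_homogeneous[OF _ keys_S_inv_deg[OF w]] by (auto simp: perp_def)
qed

lemma propQ_imp_nonzero_sum:
  fixes \<alpha> :: "nat \<Rightarrow> nat multiset \<Rightarrow> 'k::field"
  assumes fact: "of_nat (fact n) \<noteq> (0 :: 'k)" and "d \<le> n" "n \<ge> 2"
    and U: "U = pol.span ((\<lambda>i. \<Sum>\<mu>\<in>partitions d. pscale (\<alpha> i \<mu>) (Msym n \<mu>)) ` {..<r})" "U \<subseteq> R_deg n d"
    and Q: "propQ (perp n d U)"
  obtains i where "i < r" "(\<Sum>\<mu>\<in>partitions d. \<alpha> i \<mu>) \<noteq> 0"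
proof (rule ccontr)
  assume "\<not> thesis"
  then have "orbit_sum n d (\<lambda>_. 1 :: 'k) \<in> perp n d U"
    using that by (intro orbit_sum_in_perp[OF fact \<open>d \<le> n\<close> U]) auto
  moreover have "contract (xvar 0 - xvar 1) (orbit_sum n d (\<lambda>_. 1 :: 'k)) = 0"
  proof (rule poly_mapping_eqI)
    fix e :: mon
    \<comment> \<open>Either membership says that e is a monomial of degree d - 1 in the n
      variables, so contracting with variable 0 or with variable 1 gives equal coefficients; n >= 2
      puts variable 1 in range.\<close>
    have "single 0 1 + e \<in> mons n d \<longleftrightarrow> single 1 1 + e \<in> mons n d"
      using \<open>n \<ge> 2\<close> by (auto simp: mons_def keys_plus_mon)
    then show "lookup (contract (xvar 0 - xvar 1) (orbit_sum n d (\<lambda>_. 1 :: 'k))) e = lookup 0 e"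
      by (simp add: lookup_contract xvar_def lookup_orbit_sum)
  qed
  ultimately have "orbit_sum n d (\<lambda>_. 1 :: 'k) = 0"
    using Q by (auto simp: propQ_def)
  moreover have "lookup (orbit_sum n d (\<lambda>_. 1 :: 'k)) (single 0 d) = 1"
    using \<open>n \<ge> 2\<close> by (auto simp: lookup_orbit_sum mons_def)
  ultimately show False by simp
qed

text \<open>Against an invariant w, a generator \<sigma> v pairs like v, and v pairs like \<rho>(v),
  which lies in U. Against elements of degree above -d it vanishes for reasons of degree.\<close>

lemma sym_ideal_annihilates:
  fixes V :: "'k::field mpol set"
  assumes fact: "of_nat (fact n) \<noteq> (0 :: 'k)" and V: "V \<subseteq> R_deg n d"
    and U: "reynolds n ` V \<subseteq> U"
  shows "sym_ideal n V \<subseteq> Ann n {w + s | w s. w \<in> perp n d U \<and> s \<in> S_ge n (- int d + 1)}"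
proof
  fix p assume "p \<in> sym_ideal n V"
  then obtain A q where p: "p = (\<Sum>g\<in>A. q g * g)"
    "A \<subseteq> {perm_pol \<sigma> f | \<sigma> f. \<sigma> permutes {..<n} \<and> f \<in> V}" "\<forall>g\<in>A. q g \<in> R_all n"
    unfolding sym_ideal_def by blast
  have A: "g \<in> R_deg n d" if "g \<in> A" for g
    using that p(2) V perm_pol_in_R_deg by blast
  have "contract g (w + s) = 0"
    if g: "g \<in> A" and w: "w \<in> perp n d U" and s: "s \<in> S_ge n (- int d + 1)" for g w s
  proof -
    obtain \<sigma> v where v: "g = perm_pol \<sigma> v" "\<sigma> permutes {..<n}" "v \<in> V"
      using g p(2) by blast
    have w': "w \<in> S_inv_deg n (- int d)"
      using w by (simp add: perp_def)
    have "reynolds n v \<in> U"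
      using U v(3) by blast
    then have "contract (reynolds n v) w = 0"
      using w by (simp add: perp_def)
    then have "pairing (reynolds n v) (lookup w) = 0"
      using lookup_contract[of "reynolds n v" w 0] by simp
    moreover have "pairing (reynolds n v) (lookup w) = pairing v (lookup w)"
      by (intro pairing_reynolds fact lookup_S_inv_deg[OF w'])
    ultimately have "pairing g (lookup w) = 0"
      by (simp add: v(1) pairing_perm_pol lookup_S_inv_deg[OF w' v(2)])
    then show ?thesis
      using contract_homogeneous[OF A[OF g] keys_S_inv_deg[OF w']] contract_S_ge[OF A[OF g] s]
      by (simp add: contract_add_right)
  qed
  then have "contract p (w + s) = 0" if "w \<in> perp n d U" "s \<in> S_ge n (- int d + 1)" for w s
    using that unfolding p(1) contract_sum_left
    by (intro sum.neutral ballI contract_times_eq_0)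
  moreover have "p \<in> R_all n"
    unfolding p(1) using p(3) A by (intro R_all_sum R_all_times) (auto dest: R_deg_subset_R_all)
  ultimately show "p \<in> Ann n {w + s | w s. w \<in> perp n d U \<and> s \<in> S_ge n (- int d + 1)}"
    unfolding Ann_def by blast
qed

text \<open>An element p of the annihilator is cut by degree: nothing survives below d, all
  monomials above d are in the ideal, and the part of degree d is congruent to a combination of the
  h_alpha.\<close>

lemma annihilator_in_sym_ideal:
  fixes \<alpha> :: "nat \<Rightarrow> nat multiset \<Rightarrow> 'k::field" and f :: "nat \<Rightarrow> 'k mpol"
  assumes d: "d \<ge> 1" and r: "r \<ge> 1" and char: "CHAR('k) > n \<or> CHAR('k) = 0"
    and U: "U = pol.span ((\<lambda>i. \<Sum>\<mu>\<in>partitions d. pscale (\<alpha> i \<mu>) (Msym n \<mu>)) ` {..<r})" "U \<subseteq> R_deg n d"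
    and f: "\<And>i. i < r \<Longrightarrow> is_f_alpha n d ord (\<alpha> i) (f i)"
    and V: "\<And>i. i < r \<Longrightarrow> f i \<in> V"
    and Q: "propQ (perp n d U)"
  shows "Ann n {w + s | w s. w \<in> perp n d U \<and> s \<in> S_ge n (- int d + 1)} \<subseteq> sym_ideal n V"
proof
  interpret I: poly_subspace "sym_ideal n V" by (rule poly_subspace_sym_ideal)
  note fact = of_nat_fact_neq_0[OF char]
  have f0: "is_f_alpha n d ord (\<alpha> 0) (f 0)" "f 0 \<in> V"
    using f V r by auto
  have "d \<le> n" and n: "d = 1 \<or> d + 2 \<le> n"
    using is_f_alpha_large[OF f0(1) d] d by linarith+
  then have "n > 0" using d by simp
  have two: "(2 :: 'k) \<noteq> 0" if "n \<ge> 2"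
    using of_nat_neq_0_below_CHAR[OF char, of 2] that by simp
  have cong: "I.mcong m m'" if "m \<in> mons n d" "m' \<in> mons n d" "mtype m = mtype m'" for m m'
    using sym_ideal_mcong[OF f0 d two that] .
  have mult: "single (single i 1) 1 * p \<in> sym_ideal n V" if "i < n" "p \<in> sym_ideal n V" for i p
    using that by (intro sym_ideal_times single_in_R_all) auto
  have h_mem: "h_pol d (\<alpha> i) \<in> sym_ideal n V" if "i < r" for i
  proof -
    have "f i \<in> sym_ideal n V"
      using perm_pol_in_sym_ideal[OF permutes_id V[OF that]] by (simp only: perm_pol_id)
    moreover have "f i - h_pol d (\<alpha> i) \<in> sym_ideal n V"
      by (rule f_alpha_minus_h_pol[OF f[OF that] d poly_subspace_sym_ideal cong])
    ultimately show ?thesis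
      using I.subspace pol.subspace_diff[of "sym_ideal n V" "f i" "f i - h_pol d (\<alpha> i)"] by simp
  qed
  \<comment> \<open>For n = 1 variable 1 is absent and property Q gives no information. Then d = 1,
    and the sum is the one coefficient of \<alpha>^0, which is nonzero.\<close>
  obtain i where i: "i < r" "(\<Sum>\<mu>\<in>partitions d. \<alpha> i \<mu>) \<noteq> 0"
  proof (cases "n \<ge> 2")
    case True
    then show ?thesis
      using propQ_imp_nonzero_sum[OF fact \<open>d \<le> n\<close> _ U Q] that by blast
  next
    case False
    then have "d = 1" using n by simp
    then have "partitions d = {{#1#}}" by (simp only: partition_one)
    then show ?thesis
      using f_alpha_nonzero[OF f0(1) d] r by (intro that[of 0]) auto
  qed
  have exch: "I.mcong (single p 1 + m) (single q 1 + m)" if "p < n" "q < n" "m \<in> mons n d" for p q m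
    by (rule I.mcong_exchange_var[OF mult cong d n that])
  have top: "I.mcong m (single 0 (Suc d))" if "m \<in> mons n (Suc d)" for m
    using I.mcong_power_0[OF exch \<open>n > 0\<close> that] .
  define s where "s = (\<Sum>\<mu>\<in>partitions d. \<alpha> i \<mu>)"
  have power_mem: "single (single 0 (Suc d)) 1 \<in> sym_ideal n V"
  proof -
    \<comment> \<open>All terms of this multiple of h_alpha are congruent to multiples of one power
      of variable 0, so the product collapses to s times that power.\<close>
    let ?x = "single (single 0 1) 1 :: 'k mpol"
    have "?x * h_pol d (\<alpha> i) \<in> sym_ideal n V"
      using mult[OF \<open>n > 0\<close> h_mem[OF i(1)]] .
    also have "?x * h_pol d (\<alpha> i) = (\<Sum>\<mu>\<in>partitions d. single (single 0 1 + xpow \<mu>) (\<alpha> i \<mu>))"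
      by (simp add: h_pol_def sum_distrib_left mult_single)
    finally have 1: "(\<Sum>\<mu>\<in>partitions d. single (single 0 1 + xpow \<mu>) (\<alpha> i \<mu>)) \<in> sym_ideal n V" .
    have "single 0 1 + xpow \<mu> \<in> mons n (Suc d)" if "\<mu> \<in> partitions d" for \<mu>
      using xpow_in_mons[OF that \<open>d \<le> n\<close>] \<open>n > 0\<close> by (auto simp: mons_def keys_plus_mon)
    then have 2: "(\<Sum>\<mu>\<in>partitions d. single (single 0 1 + xpow \<mu>) (\<alpha> i \<mu>) - single (single 0 (Suc d)) (\<alpha> i \<mu>))
        \<in> sym_ideal n V"
      by (intro pol.subspace_sum[OF I.subspace] I.mcong_single top)
    have "(\<Sum>\<mu>\<in>partitions d. single (single 0 (Suc d)) (\<alpha> i \<mu>)) = (single (single 0 (Suc d)) s :: 'k mpol)"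
      unfolding s_def by (intro poly_mapping_eqI) (simp add: lookup_sum lookup_single when_def)
    then have "single (single 0 (Suc d)) s \<in> sym_ideal n V"
      using pol.subspace_diff[OF I.subspace 1 2] by (simp add: sum_subtractf)
    then have "pscale (1 / s) (single (single 0 (Suc d)) s) \<in> sym_ideal n V"
      by (rule pol.subspace_scale[OF I.subspace])
    then show ?thesis
      using i(2) by (simp add: pscale_single s_def)
  qed
  have above: "single m c \<in> sym_ideal n V" if "keys m \<subseteq> {..<n}" "mdeg m \<ge> Suc d" for m c
    using I.monomials_above_mem[OF mult I.mcong_mem[OF top power_mem] that] .
  fix p assume p: "p \<in> Ann n {w + s | w s. w \<in> perp n d U \<and> s \<in> S_ge n (- int d + 1)}"
  have p_R: "p \<in> R_all n"
    using p by (simp add: Ann_def)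
  \<comment> \<open>Both summands contain 0, so annihilation of the sum can be tested on each of
    them separately.\<close>
  have p_perp: "contract p w = 0" if "w \<in> perp n d U" for w
  proof -
    have "(0 :: 'k mpol) \<in> S_ge n (- int d + 1)"
      unfolding S_ge_iff by simp
    then have "w + 0 \<in> {w + s | w s. w \<in> perp n d U \<and> s \<in> S_ge n (- int d + 1)}"
      using that by blast
    then show ?thesis
      using p unfolding Ann_def by fastforce
  qed
  have p_low: "contract p s = 0" if "s \<in> S_ge n (- int d + 1)" for s
  proof -
    have "0 \<in> perp n d U"
      by (auto simp: perp_def S_inv_deg_def S_deg_iff intro!: poly_mapping_eqI)
        (simp add: lookup_contract pairing_def)
    then have "0 + s \<in> {w + s | w s. w \<in> perp n d U \<and> s \<in> S_ge n (- int d + 1)}"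
      using that by blast
    then show ?thesis
      using p unfolding Ann_def by fastforce
  qed
  \<comment> \<open>Contracting p with the divided power monomial y^(m) yields the coefficient of p
    at m as constant term; for m of degree below d that contraction is 0.\<close>
  have deg: "mdeg m \<ge> d" if m: "m \<in> keys p" for m
  proof (rule ccontr)
    assume "\<not> mdeg m \<ge> d"
    then have "contract p (single m 1) = 0"
      using m p_R unfolding R_all_iff by (intro p_low) (simp only: S_ge_iff, simp)
    then have "pairing p (lookup (single m 1)) = 0"
      using lookup_contract[of p "single m 1" 0] by simp
    moreover have "pairing p (lookup (single m 1)) = (\<Sum>k\<in>keys p. if k = m then lookup p k else 0)"
      unfolding pairing_def by (intro sum.cong) (auto simp: lookup_single when_def)
    ultimately show False
      using m by (simp add: in_keys_iff)
  qed
  define K where "K = keys p \<inter> mons n d"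
  \<comment> \<open>Collapsing every monomial to the representative of its type keeps the class
    modulo the ideal and leaves a vector indexed by partitions.\<close>
  define h where "h = (\<Sum>m\<in>K. single (xpow (mtype m)) (lookup p m))"
  have "finite K" by (simp add: K_def)
  have h_span: "h \<in> pol.span ((\<lambda>i. h_pol d (\<alpha> i)) ` {..<r})"
  proof (rule ccontr)
    assume "h \<notin> pol.span ((\<lambda>i. h_pol d (\<alpha> i)) ` {..<r})"
    then obtain \<phi> where \<phi>: "\<And>a b. \<phi> (a + b) = \<phi> a + \<phi> b" "\<And>c a. \<phi> (pscale c a) = c * \<phi> a"
      "\<And>b. b \<in> (\<lambda>i. h_pol d (\<alpha> i)) ` {..<r} \<Longrightarrow> \<phi> b = 0" "\<phi> h = 1"
      by (rule separating_functional) blast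
    have "\<phi> 0 = 0"
      using \<phi>(2)[of 0 0] by simp
    then have \<phi>_sum: "\<phi> (\<Sum>a\<in>A. g a) = (\<Sum>a\<in>A. \<phi> (g a))" for A :: "'b set" and g
      by (induction A rule: infinite_finite_induct) (auto simp: \<phi>(1))
    \<comment> \<open>Read on the representatives, \<phi> becomes the coefficient vector of an
      invariant w. It lies in the perp because \<phi> kills every h_alpha, yet contracting p with w
      has constant term \<open>\<phi> h\<close>, which is 1.\<close>
    define c where "c \<mu> = \<phi> (single (xpow \<mu>) 1)" for \<mu>
    have \<phi>_single: "\<phi> (single (xpow \<mu>) a) = a * c \<mu>" for \<mu> a
      using \<phi>(2)[of a "single (xpow \<mu>) 1"] by (simp add: pscale_single c_def)
    have "orbit_sum n d c \<in> perp n d U"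
    proof (rule orbit_sum_in_perp[OF fact \<open>d \<le> n\<close> U])
      fix i assume "i < r"
      then show "(\<Sum>\<mu>\<in>partitions d. \<alpha> i \<mu> * c \<mu>) = 0"
        using \<phi>(3)[of "h_pol d (\<alpha> i)"] by (simp add: h_pol_def \<phi>_sum \<phi>_single)
    qed
    then have "lookup (contract p (orbit_sum n d c)) 0 = 0"
      by (simp add: p_perp)
    moreover have "lookup (contract p (orbit_sum n d c)) 0
        = (\<Sum>m\<in>keys p. if m \<in> mons n d then lookup p m * c (mtype m) else 0)"
      unfolding lookup_contract pairing_def by (intro sum.cong) (auto simp: lookup_orbit_sum)
    moreover have "\<dots> = (\<Sum>m\<in>K. lookup p m * c (mtype m))"
      unfolding K_def by (simp add: sum.inter_restrict)
    moreover have "\<dots> = \<phi> h"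
      by (simp add: h_def \<phi>_sum \<phi>_single)
    ultimately show False
      using \<phi>(4) by simp
  qed
  have "h \<in> sym_ideal n V"
    using pol.span_minimal[OF _ I.subspace, of "(\<lambda>i. h_pol d (\<alpha> i)) ` {..<r}"] h_mem h_span by blast
  moreover have "(\<Sum>m\<in>K. single m (lookup p m) - single (xpow (mtype m)) (lookup p m)) \<in> sym_ideal n V"
  proof (intro pol.subspace_sum[OF I.subspace] I.mcong_single cong)
    fix m assume "m \<in> K"
    then have m: "m \<in> mons n d" by (simp add: K_def)
    then show "m \<in> mons n d" .
    show "xpow (mtype m) \<in> mons n d"
      using m \<open>d \<le> n\<close> by (intro xpow_in_mons) auto
    show "mtype m = mtype (xpow (mtype m))"
      by (simp add: mtype_xpow)
  qed
  ultimately have low: "(\<Sum>m\<in>K. single m (lookup p m)) \<in> sym_ideal n V"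
    using pol.subspace_add[OF I.subspace] by (force simp: sum_subtractf h_def)
  have high: "(\<Sum>m\<in>keys p - K. single m (lookup p m)) \<in> sym_ideal n V"
  proof (intro pol.subspace_sum[OF I.subspace] above)
    fix m assume "m \<in> keys p - K"
    then show "keys m \<subseteq> {..<n}" "mdeg m \<ge> Suc d"
      using p_R deg[of m] by (auto simp: R_all_iff K_def mons_def)
  qed
  have "p = (\<Sum>m\<in>keys p - K. single m (lookup p m)) + (\<Sum>m\<in>K. single m (lookup p m))"
    using sum.subset_diff[of K "keys p" "\<lambda>m. single m (lookup p m)"]
    by (simp add: sum_single_lookup K_def)
  then show "p \<in> sym_ideal n V"
    using pol.subspace_add[OF I.subspace high low] by simp
qed

section \<open>Assembly of the three assertions\<close>

theorem theorem6p14: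
  fixes d r n :: nat
    and ord :: "nat multiset rel"
    and \<alpha> :: "nat \<Rightarrow> nat multiset \<Rightarrow> 'k::field"
    and f :: "nat \<Rightarrow> 'k mpol"
    and U V :: "'k mpol set"
  assumes "d \<ge> 1" and "1 \<le> r" and "r \<le> num_partitions d"
    and "linear_order_on (partitions d) ord"
    and "large_enough TYPE('k) n d ord"
    and "CHAR('k) > n \<or> CHAR('k) = 0"
    and "U \<in> Gr r (R_inv_deg n d)"
    and "U = pol.span ((\<lambda>i. \<Sum>\<mu>\<in>partitions d. pscale (\<alpha> i \<mu>) (Msym n \<mu>)) ` {..<r})"
    and "\<And>i. i < r \<Longrightarrow> is_f_alpha n d ord (\<alpha> i) (f i)"
    and "V = pol.span (f ` {..<r})"
  shows "V \<in> Gr r (R_deg n d)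
    \<and> U = pol.span (reynolds n ` V)
    \<and> (\<forall>G. good_open_set n d r G \<longrightarrow> U \<in> G \<longrightarrow>
          Ann n {w + s | w s. w \<in> perp n d U \<and> s \<in> S_ge n (- int d + 1)} = sym_ideal n V)"
proof (intro conjI allI impI)
  note d = assms(1) and U = assms(8) and f = assms(9) and V = assms(10)
  have "reynolds n ` f ` {..<r} = (\<lambda>i. \<Sum>\<mu>\<in>partitions d. pscale (\<alpha> i \<mu>) (Msym n \<mu>)) ` {..<r}"
    unfolding image_image by (intro image_cong refl) (simp add: reynolds_f_alpha[OF f d])
  then have U_f: "U = pol.span (reynolds n ` f ` {..<r})"
    using U by simp
  show U_V: "U = pol.span (reynolds n ` V)"
    unfolding V by (subst linear_image_span) (auto simp: U_f)
  have V_sub: "V \<subseteq> R_deg n d"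
    unfolding V using f_alpha_in_R_deg[OF f d] by (intro pol.span_minimal subspace_R_deg) auto
  have U_sub: "U \<subseteq> R_deg n d"
    using assms(7) by (auto simp: Gr_def R_inv_deg_def)
  \<comment> \<open>\<rho> carries the r generators of V to those of U, whose span has dimension
    r.\<close>
  have "pol.dim V = r"
    unfolding V
  proof (rule dim_span_of_linear_image[where L = "reynolds n"])
    show "card (f ` {..<r}) \<le> r"
      using card_image_le[of "{..<r}" f] by simp
    show "pol.dim (pol.span (reynolds n ` f ` {..<r})) = r"
      using assms(7) by (simp add: Gr_def flip: U_f)
  qed auto
  then show "V \<in> Gr r (R_deg n d)"
    using V_sub by (simp add: Gr_def V)
  fix G assume "good_open_set n d r G" "U \<in> G"
  then have Q: "propQ (perp n d U)"
    by (simp add: good_open_set_def)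
  show "Ann n {w + s | w s. w \<in> perp n d U \<and> s \<in> S_ge n (- int d + 1)} = sym_ideal n V"
  proof
    show "sym_ideal n V \<subseteq> Ann n {w + s | w s. w \<in> perp n d U \<and> s \<in> S_ge n (- int d + 1)}"
      using U_V pol.span_superset
      by (intro sym_ideal_annihilates of_nat_fact_neq_0[OF assms(6)] V_sub) blast
    show "Ann n {w + s | w s. w \<in> perp n d U \<and> s \<in> S_ge n (- int d + 1)} \<subseteq> sym_ideal n V"
      by (rule annihilator_in_sym_ideal[OF d assms(2,6) U U_sub f _ Q])
        (auto simp: V intro: pol.span_base)
  qed
qed

end
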